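(* Let $(M,J,g)$ be a closed connected Vaisman manifold with Lee form $\theta$ satisfying $\|\theta\|=1$. Then $(g,\theta)$ is an Einstein–Weyl structure if and only if the Vaisman metric $g$ is quasi-Einstein, i.e. there exist $\lambda,\beta\in C^\infty(M)$ such that $\operatorname{Ric}=\lambda g+\beta\,\theta\otimes\theta$.
   Context: A Hermitian manifold $(M,J,g)$ (with $J$ integrable) of real dimension $2n+2$, $n\ge 1$, with fundamental form $\omega(X,Y)=g(X,JY)$, is called Vaisman if there is a nonzero 1-form $\theta$ (the Lee form), parallel for the Levi-Civita connection $\nabla$ of $g$, with $d\omega=\theta\wedge\omega$. $\operatorname{Ric}$ is the Ricci tensor of $g$. On the universal cover $\pi:\tilde M\to M$ write $\pi^*\theta=df$; then $\tilde g=e^{-f}\pi^*g$ is a Kähler metric. Its Levi-Civita connection descends to a connection $D$ on $M$ (the Weyl connection), given by $D_XY=\nabla_XY-\tfrac12\bigl(\theta(X)Y+\theta(Y)X-g(X,Y)U\bigr)$, where $U=\theta^\sharp$. The pair $(g,\theta)$ is called an Einstein–Weyl structure if $\tilde g$ is an Einstein metric, i.e. $\operatorname{Ric}^D=\lambda\tilde g$ on $\tilde M$ for some $\lambda\in\mathbb R$, where $\operatorname{Ric}^D$ is the Ricci tensor of $D$. *)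

theory Defs
  imports "HOL-Analysis.Analysis"
begin

section \<open>Calculus on open subsets of a Euclidean space\<close>

abbreviation dir_deriv ::
    "('e::real_normed_vector \<Rightarrow> 'f::real_normed_vector) \<Rightarrow> 'e \<Rightarrow> 'e \<Rightarrow> 'f"
  where "dir_deriv F x v \<equiv> frechet_derivative F (at x) v"

text \<open>Only used for open \<open>S\<close> in a Euclidean space, where it is the usual notion of
  \<open>k\<close> times continuous differentiability (all directional derivatives are of class \<open>k - 1\<close>).\<close>

primrec Ck_on ::
    "nat \<Rightarrow> 'e::euclidean_space set \<Rightarrow> ('e \<Rightarrow> 'f::real_normed_vector) \<Rightarrow> bool"
  where
    "Ck_on 0 S F \<longleftrightarrow> continuous_on S F"
  | "Ck_on (Suc k) S F \<longleftrightarrow>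
      (\<forall>x\<in>S. F differentiable (at x)) \<and> (\<forall>v. Ck_on k S (\<lambda>x. dir_deriv F x v))"

definition smooth_on :: "'e::euclidean_space set \<Rightarrow> ('e \<Rightarrow> 'f::real_normed_vector) \<Rightarrow> bool"
  where "smooth_on S F \<longleftrightarrow> (\<forall>k. Ck_on k S F)"

section \<open>Smooth manifolds\<close>

text \<open>A chart is a coordinate domain together with a coordinate map; the values of the map
  outside the domain are irrelevant.\<close>

datatype ('a, 'e) chart = Chart (cdom: "'a set") (cmap: "'a \<Rightarrow> 'e")

definition cimg :: "('a, 'e) chart \<Rightarrow> 'e set"
  where "cimg c = cmap c ` cdom c"

definition cinv :: "('a, 'e) chart \<Rightarrow> 'e \<Rightarrow> 'a"
  where "cinv c = inv_into (cdom c) (cmap c)"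

definition coord_rep :: "('a, 'e) chart \<Rightarrow> ('a \<Rightarrow> 'b) \<Rightarrow> ('b, 'e') chart \<Rightarrow> 'e \<Rightarrow> 'e'"
  where "coord_rep c F d = cmap d \<circ> F \<circ> cinv c"

locale smooth_manifold =
  fixes M :: "'a::topological_space set"
    and A :: "('a, 'e::euclidean_space) chart set"
  assumes hausdorff: "Hausdorff_space (top_of_set M)"
    and second_countable: "second_countable (top_of_set M)"
    and chart_dom: "c \<in> A \<Longrightarrow> openin (top_of_set M) (cdom c)"
    and chart_img: "c \<in> A \<Longrightarrow> open (cimg c)"
    and chart_homeo: "c \<in> A \<Longrightarrow> homeomorphism (cdom c) (cimg c) (cmap c) (cinv c)"
    and covering: "(\<Union>c\<in>A. cdom c) = M"
    and compatible: "\<lbrakk>c \<in> A; d \<in> A\<rbrakk> \<Longrightarrow>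
      smooth_on (cmap c ` (cdom c \<inter> cdom d)) (coord_rep c id d)"

definition smooth_fun :: "('a, 'e::euclidean_space) chart set \<Rightarrow> ('a \<Rightarrow> real) \<Rightarrow> bool"
  where "smooth_fun A h \<longleftrightarrow> (\<forall>c\<in>A. smooth_on (cimg c) (h \<circ> cinv c))"

definition smooth_map_on ::
    "('a::topological_space, 'e::euclidean_space) chart set \<Rightarrow>
     ('b::topological_space, 'e'::euclidean_space) chart set \<Rightarrow> 'a set \<Rightarrow> ('a \<Rightarrow> 'b) \<Rightarrow> bool"
  where "smooth_map_on A B S F \<longleftrightarrow> continuous_on S F \<and>
    (\<forall>c\<in>A. \<forall>d\<in>B. smooth_on (cmap c ` (S \<inter> cdom c \<inter> F -` cdom d)) (coord_rep c F d))"

definition local_diffeomorphism ::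
    "'b::topological_space set \<Rightarrow> ('b, 'e::euclidean_space) chart set \<Rightarrow>
     'a::topological_space set \<Rightarrow> ('a, 'e) chart set \<Rightarrow> ('b \<Rightarrow> 'a) \<Rightarrow> bool"
  where "local_diffeomorphism N B M A F \<longleftrightarrow>
    (\<forall>q\<in>N. \<exists>V. q \<in> V \<and> openin (top_of_set N) V \<and> openin (top_of_set M) (F ` V) \<and> inj_on F V \<and>
      smooth_map_on B A V F \<and> smooth_map_on A B (F ` V) (inv_into V F))"

definition universal_cover ::
    "'b::topological_space set \<Rightarrow> ('b, 'e::euclidean_space) chart set \<Rightarrow>
     'a::topological_space set \<Rightarrow> ('a, 'e) chart set \<Rightarrow> ('b \<Rightarrow> 'a) \<Rightarrow> bool"
  where "universal_cover N B M A \<pi> \<longleftrightarrow>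
    smooth_manifold N B \<and> simply_connected N \<and>
    covering_space N \<pi> M \<and> local_diffeomorphism N B M A \<pi>"

section \<open>Tensor fields\<close>

text \<open>A tensor field is given by its components in the charts of the atlas: \<open>T c x v \<dots>\<close> is its
  value, at the point with coordinates \<open>x\<close> in the chart \<open>c\<close>, on the tangent vectors with
  components \<open>v\<close>, \<open>\<dots>\<close> in that chart. The components in two charts are related by the
  derivative of the transition map.\<close>

definition one_form_on ::
    "('a, 'e::euclidean_space) chart set \<Rightarrow> (('a, 'e) chart \<Rightarrow> 'e \<Rightarrow> 'e \<Rightarrow> real) \<Rightarrow> bool"
  where "one_form_on A \<theta> \<longleftrightarrow>
    (\<forall>c\<in>A. (\<forall>x\<in>cimg c. linear (\<theta> c x)) \<and> (\<forall>v. smooth_on (cimg c) (\<lambda>x. \<theta> c x v))) \<and>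
    (\<forall>c\<in>A. \<forall>d\<in>A. \<forall>p \<in> cdom c \<inter> cdom d. \<forall>v.
      \<theta> c (cmap c p) v = \<theta> d (cmap d p) (dir_deriv (coord_rep c id d) (cmap c p) v))"

definition bilinear_field_on ::
    "('a, 'e::euclidean_space) chart set \<Rightarrow> (('a, 'e) chart \<Rightarrow> 'e \<Rightarrow> 'e \<Rightarrow> 'e \<Rightarrow> real) \<Rightarrow> bool"
  where "bilinear_field_on A g \<longleftrightarrow>
    (\<forall>c\<in>A. (\<forall>x\<in>cimg c. bilinear (g c x)) \<and> (\<forall>v w. smooth_on (cimg c) (\<lambda>x. g c x v w))) \<and>
    (\<forall>c\<in>A. \<forall>d\<in>A. \<forall>p \<in> cdom c \<inter> cdom d. \<forall>v w.
      g c (cmap c p) v w = g d (cmap d p) (dir_deriv (coord_rep c id d) (cmap c p) v)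
        (dir_deriv (coord_rep c id d) (cmap c p) w))"

definition endomorphism_field_on ::
    "('a, 'e::euclidean_space) chart set \<Rightarrow> (('a, 'e) chart \<Rightarrow> 'e \<Rightarrow> 'e \<Rightarrow> 'e) \<Rightarrow> bool"
  where "endomorphism_field_on A J \<longleftrightarrow>
    (\<forall>c\<in>A. (\<forall>x\<in>cimg c. linear (J c x)) \<and> (\<forall>v. smooth_on (cimg c) (\<lambda>x. J c x v))) \<and>
    (\<forall>c\<in>A. \<forall>d\<in>A. \<forall>p \<in> cdom c \<inter> cdom d. \<forall>v.
      dir_deriv (coord_rep c id d) (cmap c p) (J c (cmap c p) v) =
      J d (cmap d p) (dir_deriv (coord_rep c id d) (cmap c p) v))"

text \<open>The pullbacks along a smooth map \<open>F\<close> into the manifold with atlas \<open>A\<close>. By the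
  transformation rules above the choice of the chart around the image point is immaterial.\<close>

definition chart_at :: "('a, 'e) chart set \<Rightarrow> 'a \<Rightarrow> ('a, 'e) chart"
  where "chart_at A p = (SOME c. c \<in> A \<and> p \<in> cdom c)"

definition pullback_one_form ::
    "('a, 'e::euclidean_space) chart set \<Rightarrow> ('b \<Rightarrow> 'a) \<Rightarrow> (('a, 'e) chart \<Rightarrow> 'e \<Rightarrow> 'e \<Rightarrow> real) \<Rightarrow>
     ('b, 'e) chart \<Rightarrow> 'e \<Rightarrow> 'e \<Rightarrow> real"
  where "pullback_one_form A F \<theta> c x v =
    (let p = F (cinv c x); d = chart_at A p
     in \<theta> d (cmap d p) (dir_deriv (coord_rep c F d) x v))"

definition pullback_bilinear ::
    "('a, 'e::euclidean_space) chart set \<Rightarrow> ('b \<Rightarrow> 'a) \<Rightarrow>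
     (('a, 'e) chart \<Rightarrow> 'e \<Rightarrow> 'e \<Rightarrow> 'e \<Rightarrow> real) \<Rightarrow>
     ('b, 'e) chart \<Rightarrow> 'e \<Rightarrow> 'e \<Rightarrow> 'e \<Rightarrow> real"
  where "pullback_bilinear A F g c x v w =
    (let p = F (cinv c x); d = chart_at A p
     in g d (cmap d p) (dir_deriv (coord_rep c F d) x v) (dir_deriv (coord_rep c F d) x w))"

section \<open>Riemannian geometry in a chart\<close>

text \<open>In this section \<open>g\<close>, \<open>J\<close>, \<open>\<theta>\<close>, \<open>\<omega>\<close> stand for the components in one chart, and vector
  fields are maps of the coordinate space into itself. Tensors are evaluated on
  constant (coordinate) vector fields, which commute.\<close>

definition lie_bracket ::
    "('e::real_normed_vector \<Rightarrow> 'e) \<Rightarrow> ('e \<Rightarrow> 'e) \<Rightarrow> 'e \<Rightarrow> 'e"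
  where "lie_bracket X Y x = dir_deriv Y x (X x) - dir_deriv X x (Y x)"

text \<open>\<open>christoffel g x v w\<close> is \<open>\<nabla>\<^sub>v w\<close> for constant fields \<open>v\<close>, \<open>w\<close> and the Levi-Civita
  connection \<open>\<nabla>\<close> of \<open>g\<close>, as determined by the Koszul formula.\<close>

definition christoffel ::
    "('e::euclidean_space \<Rightarrow> 'e \<Rightarrow> 'e \<Rightarrow> real) \<Rightarrow> 'e \<Rightarrow> 'e \<Rightarrow> 'e \<Rightarrow> 'e"
  where "christoffel g x v w = (THE z. \<forall>u. 2 * g x z u =
    dir_deriv (\<lambda>y. g y w u) x v + dir_deriv (\<lambda>y. g y v u) x w - dir_deriv (\<lambda>y. g y v w) x u)"

definition cov_deriv ::
    "('e::real_normed_vector \<Rightarrow> 'e \<Rightarrow> 'e \<Rightarrow> 'e) \<Rightarrow> ('e \<Rightarrow> 'e) \<Rightarrow> ('e \<Rightarrow> 'e) \<Rightarrow> 'e \<Rightarrow> 'e"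
  where "cov_deriv \<Gamma> X Y x = dir_deriv Y x (X x) + \<Gamma> x (X x) (Y x)"

definition curvature ::
    "('e::real_normed_vector \<Rightarrow> 'e \<Rightarrow> 'e \<Rightarrow> 'e) \<Rightarrow>
     ('e \<Rightarrow> 'e) \<Rightarrow> ('e \<Rightarrow> 'e) \<Rightarrow> ('e \<Rightarrow> 'e) \<Rightarrow> 'e \<Rightarrow> 'e"
  where "curvature \<Gamma> X Y Z x =
    cov_deriv \<Gamma> X (cov_deriv \<Gamma> Y Z) x - cov_deriv \<Gamma> Y (cov_deriv \<Gamma> X Z) x
    - cov_deriv \<Gamma> (lie_bracket X Y) Z x"

text \<open>\<open>Ric(v, w)\<close> is the trace of \<open>u \<mapsto> R(u, v)w\<close>; the inner product of the coordinate space
  serves only to read off the diagonal entries.\<close>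

definition ricci ::
    "('e::euclidean_space \<Rightarrow> 'e \<Rightarrow> 'e \<Rightarrow> real) \<Rightarrow> 'e \<Rightarrow> 'e \<Rightarrow> 'e \<Rightarrow> real"
  where "ricci g x v w =
    (\<Sum>b\<in>Basis. curvature (christoffel g) (\<lambda>_. b) (\<lambda>_. v) (\<lambda>_. w) x \<bullet> b)"

definition cov_deriv_one_form ::
    "('e::real_normed_vector \<Rightarrow> 'e \<Rightarrow> 'e \<Rightarrow> 'e) \<Rightarrow> ('e \<Rightarrow> 'e \<Rightarrow> real) \<Rightarrow> 'e \<Rightarrow> 'e \<Rightarrow> 'e \<Rightarrow> real"
  where "cov_deriv_one_form \<Gamma> \<theta> x v w =
    dir_deriv (\<lambda>y. \<theta> y w) x v - \<theta> x (cov_deriv \<Gamma> (\<lambda>_. v) (\<lambda>_. w) x)"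

definition nijenhuis :: "('e::real_normed_vector \<Rightarrow> 'e \<Rightarrow> 'e) \<Rightarrow> 'e \<Rightarrow> 'e \<Rightarrow> 'e \<Rightarrow> 'e"
  where "nijenhuis J x v w =
    lie_bracket (\<lambda>y. J y v) (\<lambda>y. J y w) x - J x (lie_bracket (\<lambda>y. J y v) (\<lambda>_. w) x)
    - J x (lie_bracket (\<lambda>_. v) (\<lambda>y. J y w) x) - lie_bracket (\<lambda>_. v) (\<lambda>_. w) x"

text \<open>The normalisations of \<open>d\<close> and of the wedge product are those without combinatorial
  factors, so that \<open>d(h \<omega>) = dh \<and> \<omega> + h d\<omega>\<close>.\<close>

definition ext_deriv_two_form ::
    "('e::real_normed_vector \<Rightarrow> 'e \<Rightarrow> 'e \<Rightarrow> real) \<Rightarrow> 'e \<Rightarrow> 'e \<Rightarrow> 'e \<Rightarrow> 'e \<Rightarrow> real"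
  where "ext_deriv_two_form \<omega> x u v w =
    dir_deriv (\<lambda>y. \<omega> y v w) x u + dir_deriv (\<lambda>y. \<omega> y w u) x v + dir_deriv (\<lambda>y. \<omega> y u v) x w"

definition wedge_one_two ::
    "('e \<Rightarrow> 'e \<Rightarrow> real) \<Rightarrow> ('e \<Rightarrow> 'e \<Rightarrow> 'e \<Rightarrow> real) \<Rightarrow> 'e \<Rightarrow> 'e \<Rightarrow> 'e \<Rightarrow> 'e \<Rightarrow> real"
  where "wedge_one_two \<theta> \<omega> x u v w =
    \<theta> x u * \<omega> x v w + \<theta> x v * \<omega> x w u + \<theta> x w * \<omega> x u v"

definition fundamental_form ::
    "('e \<Rightarrow> 'e \<Rightarrow> 'e \<Rightarrow> real) \<Rightarrow> ('e \<Rightarrow> 'e \<Rightarrow> 'e) \<Rightarrow> 'e \<Rightarrow> 'e \<Rightarrow> 'e \<Rightarrow> real"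
  where "fundamental_form g J x v w = g x v (J x w)"

definition sharp :: "('e \<Rightarrow> 'e \<Rightarrow> 'e \<Rightarrow> real) \<Rightarrow> ('e \<Rightarrow> 'e \<Rightarrow> real) \<Rightarrow> 'e \<Rightarrow> 'e"
  where "sharp g \<theta> x = (THE u. \<forall>v. g x u v = \<theta> x v)"

definition one_form_norm :: "('e \<Rightarrow> 'e \<Rightarrow> 'e \<Rightarrow> real) \<Rightarrow> ('e \<Rightarrow> 'e \<Rightarrow> real) \<Rightarrow> 'e \<Rightarrow> real"
  where "one_form_norm g \<theta> x = sqrt (g x (sharp g \<theta> x) (sharp g \<theta> x))"

section \<open>Vaisman manifolds\<close>

locale riemannian_manifold = smooth_manifold M A
  for M :: "'a::topological_space set" and A :: "('a, 'e::euclidean_space) chart set" +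
  fixes g :: "('a, 'e) chart \<Rightarrow> 'e \<Rightarrow> 'e \<Rightarrow> 'e \<Rightarrow> real"
  assumes metric_tensor: "bilinear_field_on A g"
    and metric_sym: "\<lbrakk>c \<in> A; x \<in> cimg c\<rbrakk> \<Longrightarrow> g c x v w = g c x w v"
    and metric_pos: "\<lbrakk>c \<in> A; x \<in> cimg c; v \<noteq> 0\<rbrakk> \<Longrightarrow> g c x v v > 0"

locale hermitian_manifold = riemannian_manifold M A g
  for M :: "'a::topological_space set" and A :: "('a, 'e::euclidean_space) chart set" and g +
  fixes J :: "('a, 'e) chart \<Rightarrow> 'e \<Rightarrow> 'e \<Rightarrow> 'e"
  assumes J_tensor: "endomorphism_field_on A J"
    and J_square: "\<lbrakk>c \<in> A; x \<in> cimg c\<rbrakk> \<Longrightarrow> J c x (J c x v) = - v"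
    and J_integrable: "\<lbrakk>c \<in> A; x \<in> cimg c\<rbrakk> \<Longrightarrow> nijenhuis (J c) x v w = 0"
    and J_metric: "\<lbrakk>c \<in> A; x \<in> cimg c\<rbrakk> \<Longrightarrow> g c x (J c x v) (J c x w) = g c x v w"

locale vaisman_manifold = hermitian_manifold M A g J
  for M :: "'a::topological_space set" and A :: "('a, 'e::euclidean_space) chart set" and g J +
  fixes \<theta> :: "('a, 'e) chart \<Rightarrow> 'e \<Rightarrow> 'e \<Rightarrow> real"
  assumes lee_tensor: "one_form_on A \<theta>"
    and lee_nonzero: "\<exists>c\<in>A. \<exists>x\<in>cimg c. \<exists>v. \<theta> c x v \<noteq> 0"
    and lee_parallel: "\<lbrakk>c \<in> A; x \<in> cimg c\<rbrakk> \<Longrightarrow>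
      cov_deriv_one_form (christoffel (g c)) (\<theta> c) x v w = 0"
    and lee_form: "\<lbrakk>c \<in> A; x \<in> cimg c\<rbrakk> \<Longrightarrow>
      ext_deriv_two_form (fundamental_form (g c) (J c)) x u v w =
      wedge_one_two (\<theta> c) (fundamental_form (g c) (J c)) x u v w"

section \<open>Einstein-Weyl and quasi-Einstein structures\<close>

definition einstein_metric ::
    "('a, 'e::euclidean_space) chart set \<Rightarrow> (('a, 'e) chart \<Rightarrow> 'e \<Rightarrow> 'e \<Rightarrow> 'e \<Rightarrow> real) \<Rightarrow> bool"
  where "einstein_metric A g \<longleftrightarrow>
    (\<exists>k::real. \<forall>c\<in>A. \<forall>x\<in>cimg c. \<forall>v w. ricci (g c) x v w = k * g c x v w)"

text \<open>\<open>f\<close> is a smooth function with \<open>df = \<pi>\<^sup>*\<theta>\<close>, where \<open>\<pi>\<close> maps the manifold with atlas \<open>B\<close> to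
  the one with atlas \<open>A\<close>.\<close>

definition lee_potential ::
    "('b, 'e::euclidean_space) chart set \<Rightarrow> ('a, 'e) chart set \<Rightarrow> ('b \<Rightarrow> 'a) \<Rightarrow>
     (('a, 'e) chart \<Rightarrow> 'e \<Rightarrow> 'e \<Rightarrow> real) \<Rightarrow> ('b \<Rightarrow> real) \<Rightarrow> bool"
  where "lee_potential B A \<pi> \<theta> f \<longleftrightarrow> smooth_fun B f \<and>
    (\<forall>c\<in>B. \<forall>x\<in>cimg c. \<forall>v. dir_deriv (f \<circ> cinv c) x v = pullback_one_form A \<pi> \<theta> c x v)"

definition kaehler_cover_metric ::
    "('a, 'e::euclidean_space) chart set \<Rightarrow> ('b \<Rightarrow> 'a) \<Rightarrow> ('b \<Rightarrow> real) \<Rightarrow>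
     (('a, 'e) chart \<Rightarrow> 'e \<Rightarrow> 'e \<Rightarrow> 'e \<Rightarrow> real) \<Rightarrow> ('b, 'e) chart \<Rightarrow> 'e \<Rightarrow> 'e \<Rightarrow> 'e \<Rightarrow> real"
  where "kaehler_cover_metric A \<pi> f g c x v w =
    exp (- f (cinv c x)) * pullback_bilinear A \<pi> g c x v w"

text \<open>The Levi-Civita connection of the metric on the cover is the lift of the Weyl connection
  \<open>D\<close>, so the Ricci tensor occurring here is \<open>Ric\<^sup>D\<close>.\<close>

definition einstein_weyl ::
    "('b, 'e::euclidean_space) chart set \<Rightarrow> ('a, 'e) chart set \<Rightarrow> ('b \<Rightarrow> 'a) \<Rightarrow> ('b \<Rightarrow> real) \<Rightarrow>
     (('a, 'e) chart \<Rightarrow> 'e \<Rightarrow> 'e \<Rightarrow> 'e \<Rightarrow> real) \<Rightarrow> bool"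
  where "einstein_weyl B A \<pi> f g \<longleftrightarrow> einstein_metric B (kaehler_cover_metric A \<pi> f g)"

definition quasi_einstein ::
    "('a, 'e::euclidean_space) chart set \<Rightarrow> (('a, 'e) chart \<Rightarrow> 'e \<Rightarrow> 'e \<Rightarrow> 'e \<Rightarrow> real) \<Rightarrow>
     (('a, 'e) chart \<Rightarrow> 'e \<Rightarrow> 'e \<Rightarrow> real) \<Rightarrow> bool"
  where "quasi_einstein A g \<theta> \<longleftrightarrow>
    (\<exists>\<alpha> \<beta>. smooth_fun A \<alpha> \<and> smooth_fun A \<beta> \<and>
      (\<forall>c\<in>A. \<forall>p\<in>cdom c. \<forall>v w.
        ricci (g c) (cmap c p) v w =
        \<alpha> p * g c (cmap c p) v w + \<beta> p * (\<theta> c (cmap c p) v * \<theta> c (cmap c p) w)))"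

end

theory Submission
  imports Defs
begin

text \<open>In the charts of \<open>M\<close> let \<open>D\<close> be the Weyl connection, \<open>U\<close> the unit parallel field dual to
  \<open>\<theta>\<close> and \<open>m = 2 n + 2\<close>. As \<open>\<theta>\<close> is parallel, \<open>Ric\<^sup>D = Ric + (m - 2) / 4 (\<theta> \<otimes> \<theta> - g)\<close>
  and \<open>Ric(\<cdot>, U) = 0\<close>. Moreover \<open>D U = - id / 2\<close>, and \<open>D J = 0\<close> as for Kaehler metrics, so
  \<open>D(J U) = - J / 2\<close>; since \<open>D\<close> is torsion free, \<open>R\<^sup>D(\<cdot>, \<cdot>)\<close> kills both \<open>U\<close> and \<open>J U\<close>. The
  Levi-Civita connection of the metric on the cover is the pullback of \<open>D\<close>. If that metric is
  Einstein with constant \<open>k\<close>, evaluation at \<open>(U, U)\<close> gives \<open>k = 0\<close>, hence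
  \<open>Ric = n / 2 (g - \<theta> \<otimes> \<theta>)\<close>. If conversely \<open>Ric = \<alpha> g + \<beta> \<theta> \<otimes> \<theta>\<close>, evaluation at \<open>(U, U)\<close> and at
  \<open>(J U, J U)\<close> gives \<open>\<alpha> + \<beta> = 0\<close> and \<open>\<alpha> = n / 2\<close>, hence \<open>Ric\<^sup>D = 0\<close>.\<close>

section \<open>Differentiability of linear systems, symmetry of second derivatives, cyclicity of the
  trace\<close>

section \<open>Calculus\<close>

text \<open>Split off \<open>m x *\<^sub>R n y\<close>. In the rest, \<open>m y - m x\<close> tends
  to 0 and \<open>n y\<close> is of the order of \<open>norm (y - x)\<close>, so continuity of
  \<open>m\<close> is enough. The rule serves where a factor is known to be continuous but not yet
  differentiable.\<close>

lemma has_derivative_scaleR_vanishing: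
  fixes m :: "'a::real_normed_vector \<Rightarrow> real" and n :: "'a \<Rightarrow> 'b::real_normed_vector"
  assumes m: "isCont m x" and n: "(n has_derivative n') (at x)" and 0: "n x = 0"
  shows "((\<lambda>y. m y *\<^sub>R n y) has_derivative (\<lambda>h. m x *\<^sub>R n' h)) (at x)"
proof -
  have bl: "bounded_linear n'"
    using n by (rule has_derivative_bounded_linear)
  have rest: "((\<lambda>y. (m y - m x) *\<^sub>R n y) has_derivative (\<lambda>h. 0)) (at x)"
    unfolding has_derivative_at_alt
  proof (intro conjI allI impI bounded_linear_zero)
    fix e :: real assume e: "e > 0"
    obtain K where K: "K > 0" "\<And>h. norm (n' h) \<le> norm h * K"
      using bounded_linear.pos_bounded[OF bl] by blast
    obtain d1 where d1: "d1 > 0"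
      "\<And>y. norm (y - x) < d1 \<Longrightarrow> norm (n y - n x - n' (y - x)) \<le> 1 * norm (y - x)"
      using n unfolding has_derivative_at_alt by (metis zero_less_one)
    \<comment> \<open>Near \<open>x\<close> the norm of \<open>n y\<close> is at most
      \<open>K + 1\<close> times the distance: \<open>K\<close> from the derivative and 1 from the
      remainder. The oscillation of \<open>m\<close> is chosen to compensate this factor.\<close>
    have "e / (K + 1) > 0"
      using e K by simp
    then obtain d2 where d2: "d2 > 0"
      "\<And>y. norm (y - x) < d2 \<Longrightarrow> \<bar>m y - m x\<bar> < e / (K + 1)"
      using m unfolding continuous_at_eps_delta by (metis dist_norm real_norm_def)
    have "norm ((m y - m x) *\<^sub>R n y - (m x - m x) *\<^sub>R n x - 0) \<le> e * norm (y - x)"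
      if y: "norm (y - x) < min d1 d2" for y
    proof -
      have "norm (n y) \<le> norm (n y - n x - n' (y - x)) + norm (n' (y - x))"
        by (metis 0 diff_zero norm_triangle_sub add.commute)
      also have "\<dots> \<le> (K + 1) * norm (y - x)"
        using d1(2)[of y] K(2)[of "y - x"] y by (simp add: algebra_simps)
      finally have ny: "norm (n y) \<le> (K + 1) * norm (y - x)" .
      have "\<bar>m y - m x\<bar> * norm (n y) \<le> e / (K + 1) * ((K + 1) * norm (y - x))"
        using d2(2)[of y] y ny K(1) e by (intro mult_mono) auto
      then show ?thesis
        using K(1) by simp
    qed
    then show "\<exists>d>0. \<forall>y. norm (y - x) < d \<longrightarrow>
        norm ((m y - m x) *\<^sub>R n y - (m x - m x) *\<^sub>R n x - 0) \<le> e * norm (y - x)"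
      using d1(1) d2(1) by (intro exI[of _ "min d1 d2"]) auto
  qed
  have "((\<lambda>y. (m y - m x) *\<^sub>R n y + m x *\<^sub>R n y) has_derivative (\<lambda>h. 0 + m x *\<^sub>R n' h)) (at x)"
    by (intro has_derivative_add rest has_derivative_scaleR_right n)
  then show ?thesis
    by (simp add: algebra_simps)
qed

lemma linear_eq_sum_Basis:
  fixes L :: "'b::euclidean_space \<Rightarrow> 'c::real_normed_vector"
  assumes "linear L"
  shows "L v = (\<Sum>b\<in>Basis. (v \<bullet> b) *\<^sub>R L b)"
proof -
  have "L v = L (\<Sum>b\<in>Basis. (v \<bullet> b) *\<^sub>R b)"
    by (simp add: euclidean_representation)
  also have "\<dots> = (\<Sum>b\<in>Basis. (v \<bullet> b) *\<^sub>R L b)"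
    by (simp only: linear_sum[OF assms] linear_scale[OF assms])
  finally show ?thesis .
qed

text \<open>With a left inverse \<open>P\<close> of \<open>L x\<close> the system becomes the
  fixed-point equation \<open>z y = P (k y) - E y (z y)\<close>, where \<open>E y\<close> vanishes
  at \<open>y = x\<close>. Smallness of \<open>E\<close> first gives continuity of \<open>z\<close>;
  the product rule for a vanishing factor then gives differentiability.\<close>

lemma linear_solution_differentiable:
  fixes z :: "'a::real_normed_vector \<Rightarrow> 'b::euclidean_space"
    and L :: "'a \<Rightarrow> 'b \<Rightarrow> 'c::euclidean_space"
  assumes S: "open S" "x \<in> S"
    and lin: "\<And>y. y \<in> S \<Longrightarrow> linear (L y)"
    and diff: "\<And>v. (\<lambda>y. L y v) differentiable (at x)"
    and inj: "inj (L x)"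
    and rhs: "(\<lambda>y. L y (z y)) differentiable (at x)"
  shows "z differentiable (at x)"
proof -
  obtain P where P: "linear P" "\<And>v. P (L x v) = v"
    using linear_injective_left_inverse[OF lin[OF S(2)] inj] by (metis comp_apply id_apply)
  define k where "k y = L y (z y)" for y
  define E where "E y v = P (L y v - L x v)" for y v
  have linE: "linear (E y)" if "y \<in> S" for y
    unfolding E_def using linear_compose[OF linear_compose_sub[OF lin[OF that] lin[OF S(2)]] P(1)]
    by (simp add: o_def)
  have Pk_eq: "P (k y) = z y + E y (z y)" for y
    by (simp add: k_def E_def linear_diff[OF P(1)] P(2))
  then have z: "z y = P (k y) - E y (z y)" for y
    by simp
  have blP: "bounded_linear P"
    using P(1) by (simp add: linear_conv_bounded_linear)
  have Pk: "(\<lambda>y. P (k y)) differentiable (at x)"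
    using bounded_linear.has_derivative[OF blP] rhs unfolding k_def differentiable_def by blast
  have Ed: "(\<lambda>y. E y v) differentiable (at x)" for v
    using bounded_linear.has_derivative[OF blP has_derivative_diff[OF _ has_derivative_const]] diff[of v]
    unfolding E_def differentiable_def by blast
  have E0: "E x v = 0" for v
    by (simp add: E_def linear_0[OF P(1)])
  define \<eta> where "\<eta> y = (\<Sum>b\<in>Basis. norm (E y b))" for y
  have E\<eta>: "norm (E y v) \<le> \<eta> y * norm v" if "y \<in> S" for y v
  proof -
    have "norm (E y v) \<le> (\<Sum>b\<in>Basis. norm ((v \<bullet> b) *\<^sub>R E y b))"
      by (subst linear_eq_sum_Basis[OF linE[OF that]]) (rule norm_sum)
    also have "\<dots> \<le> (\<Sum>b\<in>Basis. norm v * norm (E y b))"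
      by (intro sum_mono) (auto intro!: mult_right_mono simp: Basis_le_norm)
    finally show ?thesis
      by (simp add: \<eta>_def sum_distrib_left sum_distrib_right mult.commute)
  qed
  have cE: "isCont (\<lambda>y. E y b) x" for b
    using Ed differentiable_imp_continuous_within by blast
  have c\<eta>: "(\<eta> \<longlongrightarrow> 0) (at x)"
  proof -
    have "isCont \<eta> x"
      unfolding \<eta>_def by (intro continuous_intros cE)
    then show ?thesis
      unfolding isCont_def by (simp add: \<eta>_def E0)
  qed
  have cPk: "isCont (\<lambda>y. P (k y)) x"
    using Pk differentiable_imp_continuous_within by blast
  have near: "\<forall>\<^sub>F y in at x. y \<in> S"
    using S by (intro eventually_at_in_open') auto
  have small: "\<forall>\<^sub>F y in at x. \<eta> y < 1 / 2"
    by (rule order_tendstoD(2)[OF c\<eta>]) simp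
  have Pkx: "P (k x) = z x"
    by (simp add: k_def P(2))
  \<comment> \<open>Once \<open>\<eta> y < 1/2\<close>, the term \<open>E y (z y)\<close> is
    absorbed and \<open>z y\<close> is bounded by twice \<open>P (k y)\<close>; hence
    \<open>E y (z y)\<close> tends to 0.\<close>
  have "isCont z x"
    unfolding isCont_def
  proof (rule Lim_null_comparison[THEN LIM_zero_cancel])
    show "\<forall>\<^sub>F y in at x. norm (z y - z x) \<le> norm (P (k y) - z x) + \<eta> y * (2 * norm (P (k y)))"
      using near small
    proof eventually_elim
      case (elim y)
      have 1: "norm (E y (z y)) \<le> \<eta> y * norm (z y)"
        using E\<eta> elim by blast
      have "norm (z y) \<le> norm (P (k y)) + norm (E y (z y))"
        using z[of y] norm_triangle_ineq4[of "P (k y)" "E y (z y)"] by simp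
      moreover have "\<eta> y * norm (z y) \<le> 1 / 2 * norm (z y)"
        using elim by (intro mult_right_mono) auto
      ultimately have 2: "norm (z y) \<le> 2 * norm (P (k y))"
        using 1 by linarith
      have "\<eta> y \<ge> 0"
        by (simp add: \<eta>_def sum_nonneg)
      then have "\<eta> y * norm (z y) \<le> \<eta> y * (2 * norm (P (k y)))"
        using 2 by (intro mult_left_mono)
      moreover have "norm (z y - z x) \<le> norm (P (k y) - z x) + norm (E y (z y))"
        using norm_triangle_ineq4[of "P (k y) - z x" "E y (z y)"] by (simp add: Pk_eq)
      ultimately show ?case
        using 1 by linarith
    qed
    have "((\<lambda>y. norm (P (k y) - z x) + \<eta> y * (2 * norm (P (k y)))) \<longlongrightarrow>
        norm (P (k x) - z x) + 0 * (2 * norm (P (k x)))) (at x)"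
      using cPk unfolding isCont_def by (intro tendsto_intros c\<eta>)
    then show "((\<lambda>y. norm (P (k y) - z x) + \<eta> y * (2 * norm (P (k y)))) \<longlongrightarrow> 0) (at x)"
      by (simp add: Pkx)
  qed
  then have cz: "isCont (\<lambda>y. z y \<bullet> b) x" for b
    by (intro continuous_intros)
  \<comment> \<open>The coordinates of \<open>z\<close> are now continuous and
    \<open>E x b = 0\<close>, which is what the product rule with a merely continuous factor asks
    for.\<close>
  have "(\<lambda>y. (z y \<bullet> b) *\<^sub>R E y b) differentiable (at x)" for b
    using has_derivative_scaleR_vanishing[where m = "\<lambda>y. z y \<bullet> b" and n = "\<lambda>y. E y b", OF cz _ E0] Ed[of b]
    unfolding differentiable_def by blast
  then have "(\<lambda>y. P (k y) - (\<Sum>b\<in>Basis. (z y \<bullet> b) *\<^sub>R E y b)) differentiable (at x)"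
    by (intro differentiable_diff Pk differentiable_sum) auto
  then obtain D where D: "((\<lambda>y. P (k y) - (\<Sum>b\<in>Basis. (z y \<bullet> b) *\<^sub>R E y b)) has_derivative D) (at x)"
    unfolding differentiable_def by blast
  have "(z has_derivative D) (at x)"
    by (rule has_derivative_transform_within_open[OF D S])
      (metis z linear_eq_sum_Basis[OF linE])
  then show ?thesis
    unfolding differentiable_def by blast
qed

text \<open>Leibniz rule when \<open>L\<close> is differentiable on each fixed vector separately:
  expand \<open>X y\<close> in the basis, and let uniqueness of derivatives recombine the
  \<open>L' b\<close> into \<open>L' (X x)\<close>.\<close>

lemma has_derivative_linear_field:
  fixes L :: "'a::real_normed_vector \<Rightarrow> 'b::euclidean_space \<Rightarrow> 'c::real_normed_vector"
  assumes S: "open S" "x \<in> S"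
    and lin: "\<And>y. y \<in> S \<Longrightarrow> linear (L y)"
    and L': "\<And>v. ((\<lambda>y. L y v) has_derivative L' v) (at x)"
    and X: "(X has_derivative X') (at x)"
  shows "((\<lambda>y. L y (X y)) has_derivative (\<lambda>h. L' (X x) h + L x (X' h))) (at x)"
proof -
  have "((\<lambda>y. \<Sum>b\<in>Basis. (X y \<bullet> b) *\<^sub>R L y b) has_derivative
      (\<lambda>h. \<Sum>b\<in>Basis. (X x \<bullet> b) *\<^sub>R L' b h + (X' h \<bullet> b) *\<^sub>R L x b)) (at x)"
    by (intro has_derivative_sum has_derivative_scaleR L' has_derivative_inner_left X)
  moreover have "(\<Sum>b\<in>Basis. (X x \<bullet> b) *\<^sub>R L' b h) = L' (X x) h" for h
  proof -
    have "((\<lambda>y. \<Sum>b\<in>Basis. (X x \<bullet> b) *\<^sub>R L y b) has_derivative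
        (\<lambda>h. \<Sum>b\<in>Basis. (X x \<bullet> b) *\<^sub>R L' b h)) (at x)"
      by (intro has_derivative_sum has_derivative_scaleR_right L')
    then have "((\<lambda>y. L y (X x)) has_derivative (\<lambda>h. \<Sum>b\<in>Basis. (X x \<bullet> b) *\<^sub>R L' b h)) (at x)"
      by (rule has_derivative_transform_within_open[OF _ S]) (metis linear_eq_sum_Basis[OF lin])
    then show ?thesis
      by (metis L' has_derivative_unique)
  qed
  ultimately have "((\<lambda>y. \<Sum>b\<in>Basis. (X y \<bullet> b) *\<^sub>R L y b) has_derivative
      (\<lambda>h. L' (X x) h + L x (X' h))) (at x)"
    by (simp add: sum.distrib flip: linear_eq_sum_Basis[OF lin[OF S(2)]])
  then show ?thesis
    by (rule has_derivative_transform_within_open[OF _ S]) (metis linear_eq_sum_Basis[OF lin])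
qed

lemma has_derivative_bilinear_field:
  fixes L :: "'a::real_normed_vector \<Rightarrow> 'b::euclidean_space \<Rightarrow> 'd::euclidean_space \<Rightarrow> 'c::real_normed_vector"
  assumes S: "open S" "x \<in> S"
    and lin: "\<And>y. y \<in> S \<Longrightarrow> bilinear (L y)"
    and L': "\<And>v w. ((\<lambda>y. L y v w) has_derivative L' v w) (at x)"
    and X: "(X has_derivative X') (at x)"
    and Y: "(Y has_derivative Y') (at x)"
  shows "((\<lambda>y. L y (X y) (Y y)) has_derivative
    (\<lambda>h. L' (X x) (Y x) h + L x (X' h) (Y x) + L x (X x) (Y' h))) (at x)"
proof -
  have 1: "((\<lambda>y. L y (X y) w) has_derivative (\<lambda>h. L' (X x) w h + L x (X' h) w)) (at x)" for w
    using lin by (intro has_derivative_linear_field[OF S, where L = "\<lambda>y v. L y v w"] L' X)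
      (auto simp: bilinear_def)
  show ?thesis
    using lin by (intro has_derivative_linear_field[OF S, where L = "\<lambda>y w. L y (X y) w"] 1 Y)
      (auto simp: bilinear_def)
qed

text \<open>The second difference over a parallelogram of size \<open>t\<close> is an increment of
  first differences. The mean value theorem turns it into a difference of values of
  \<open>F' _ u\<close>, and differentiability of that function at the single point \<open>x\<close>
  evaluates it up to \<open>o(t^2)\<close>.\<close>

lemma second_difference_estimate:
  fixes F :: "'a::real_normed_vector \<Rightarrow> real"
  assumes S: "open S" "x \<in> S"
    and F: "\<And>y. y \<in> S \<Longrightarrow> (F has_derivative F' y) (at y)"
    and F'': "((\<lambda>y. F' y u) has_derivative A) (at x)"
    and e: "e > 0"
  shows "\<forall>\<^sub>F t in at_right 0.
    \<bar>F (x + t *\<^sub>R u + t *\<^sub>R v) - F (x + t *\<^sub>R u) - F (x + t *\<^sub>R v) + F x - t\<^sup>2 * A v\<bar>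
    \<le> t\<^sup>2 * (2 * e * (norm u + norm v))"
proof -
  define K where "K = norm u + norm v"
  have K: "K \<ge> 0"
    by (simp add: K_def)
  have lA: "linear A"
    using F'' has_derivative_linear by blast
  obtain r where r: "r > 0" "ball x r \<subseteq> S"
    using S openE by blast
  obtain d where d: "d > 0"
    "\<And>y. norm (y - x) < d \<Longrightarrow> \<bar>F' y u - F' x u - A (y - x)\<bar> \<le> e * norm (y - x)"
    using F'' e unfolding has_derivative_at_alt real_norm_def by metis
  \<comment> \<open>This keeps the whole parallelogram inside \<open>S\<close> and within the range
    of the derivative estimate; \<open>K + 1\<close> avoids division by zero when \<open>u\<close>
    and \<open>v\<close> vanish.\<close>
  have "\<forall>\<^sub>F t in at_right 0. t < min d r / (K + 1)"
    using d r K by (intro order_tendstoD(2)[OF tendsto_ident_at]) auto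
  moreover have "\<forall>\<^sub>F t in at_right (0::real). 0 < t"
    by (rule eventually_at_right_less)
  ultimately show ?thesis
  proof eventually_elim
    case (elim t)
    have tK: "t * K < d" "t * K < r"
    proof -
      have "t * (K + 1) < min d r"
        using elim K by (simp add: field_simps)
      then show "t * K < d" "t * K < r"
        using elim by (auto simp: algebra_simps)
    qed
    have bnd: "norm (s *\<^sub>R u + s' *\<^sub>R v) \<le> t * K" if "0 \<le> s" "s \<le> t" "0 \<le> s'" "s' \<le> t" for s s'
    proof -
      have "norm (s *\<^sub>R u + s' *\<^sub>R v) \<le> s * norm u + s' * norm v"
        using that by (intro norm_triangle_le) simp
      also have "\<dots> \<le> t * norm u + t * norm v"
        using that by (intro add_mono mult_right_mono) auto
      finally show ?thesis
        by (simp add: K_def algebra_simps)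
    qed
    have inS: "x + s *\<^sub>R u + s' *\<^sub>R v \<in> S" if "0 \<le> s" "s \<le> t" "0 \<le> s'" "s' \<le> t" for s s'
    proof -
      have "dist x (x + s *\<^sub>R u + s' *\<^sub>R v) = norm (s *\<^sub>R u + s' *\<^sub>R v)"
        by (metis add.assoc add_diff_cancel_left' dist_commute dist_norm)
      then show ?thesis
        using bnd[OF that] tK r by (auto simp: subset_eq)
    qed
    \<comment> \<open>\<open>G t - G 0\<close> is the second difference, and the mean value theorem
      is applied to \<open>G\<close> along \<open>u\<close>.\<close>
    define G where "G s = F (x + s *\<^sub>R u + t *\<^sub>R v) - F (x + s *\<^sub>R u)" for s
    have "\<exists>s\<in>{0<..<t}. G t - G 0 =
        (\<lambda>h. F' (x + s *\<^sub>R u + t *\<^sub>R v) (h *\<^sub>R u) - F' (x + s *\<^sub>R u) (h *\<^sub>R u)) (t - 0)"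
    proof (rule mvt_simple)
      fix s assume s: "0 \<le> s" "s \<le> t"
      have 1: "(F has_derivative F' (x + s *\<^sub>R u + t *\<^sub>R v)) (at (x + s *\<^sub>R u + t *\<^sub>R v))"
        using inS[of s t] s elim by (intro F) auto
      have 2: "(F has_derivative F' (x + s *\<^sub>R u)) (at (x + s *\<^sub>R u))"
        using inS[of s 0] s elim by (intro F) auto
      have "((\<lambda>s. x + s *\<^sub>R u + t *\<^sub>R v) has_derivative (\<lambda>h. h *\<^sub>R u)) (at s within {0..t})"
        by (auto intro!: derivative_eq_intros)
      from has_derivative_compose[OF this 1]
      have 3: "((\<lambda>s. F (x + s *\<^sub>R u + t *\<^sub>R v)) has_derivative
          (\<lambda>h. F' (x + s *\<^sub>R u + t *\<^sub>R v) (h *\<^sub>R u))) (at s within {0..t})" .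
      have "((\<lambda>s. x + s *\<^sub>R u) has_derivative (\<lambda>h. h *\<^sub>R u)) (at s within {0..t})"
        by (auto intro!: derivative_eq_intros)
      from has_derivative_compose[OF this 2]
      have 4: "((\<lambda>s. F (x + s *\<^sub>R u)) has_derivative (\<lambda>h. F' (x + s *\<^sub>R u) (h *\<^sub>R u))) (at s within {0..t})" .
      show "(G has_derivative (\<lambda>h. F' (x + s *\<^sub>R u + t *\<^sub>R v) (h *\<^sub>R u) - F' (x + s *\<^sub>R u) (h *\<^sub>R u)))
          (at s within {0..t})"
        unfolding G_def using 3 4 by (rule has_derivative_diff)
    qed (use elim in simp)
    then obtain s where s: "0 < s" "s < t"
      and Gs: "G t - G 0 = F' (x + s *\<^sub>R u + t *\<^sub>R v) (t *\<^sub>R u) - F' (x + s *\<^sub>R u) (t *\<^sub>R u)"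
      by auto
    have lin: "F' y (t *\<^sub>R u) = t * F' y u" if "y \<in> S" for y
      using linear_scale[OF has_derivative_linear[OF F[OF that]]] by simp
    have G: "G t - G 0 = t * (F' (x + s *\<^sub>R u + t *\<^sub>R v) u - F' (x + s *\<^sub>R u) u)"
      using Gs lin[OF inS[of s t]] lin[OF inS[of s 0]] s elim by (simp add: algebra_simps)
    \<comment> \<open>Both arguments are expanded around \<open>x\<close>; since
      \<open>?p - ?q = t *\<^sub>R v\<close>, the linear terms leave \<open>t * A v\<close>.\<close>
    let ?p = "s *\<^sub>R u + t *\<^sub>R v" and ?q = "s *\<^sub>R u"
    have p: "norm ?p \<le> t * K"
      using bnd[of s t] s elim by simp
    have q: "norm ?q \<le> t * K"
      using bnd[of s 0] s elim by simp
    have "\<bar>F' (x + ?p) u - F' x u - A ?p\<bar> \<le> e * norm ?p"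
      using d(2)[of "x + ?p"] p tK by simp
    also have "\<dots> \<le> e * (t * K)"
      using p e by simp
    finally have 1: "\<bar>F' (x + ?p) u - F' x u - A ?p\<bar> \<le> e * (t * K)" .
    have "\<bar>F' (x + ?q) u - F' x u - A ?q\<bar> \<le> e * norm ?q"
      using d(2)[of "x + ?q"] q tK by simp
    also have "\<dots> \<le> e * (t * K)"
      using q e by simp
    finally have 2: "\<bar>F' (x + ?q) u - F' x u - A ?q\<bar> \<le> e * (t * K)" .
    have "A ?p - A ?q = t * A v"
      by (simp add: linear_add[OF lA] linear_scale[OF lA])
    then have "\<bar>F' (x + ?p) u - F' (x + ?q) u - t * A v\<bar> \<le> 2 * (e * (t * K))"
      using 1 2 by linarith
    then have "t * \<bar>F' (x + ?p) u - F' (x + ?q) u - t * A v\<bar> \<le> t * (2 * (e * (t * K)))"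
      using elim by (intro mult_left_mono) auto
    moreover have "t * \<bar>F' (x + ?p) u - F' (x + ?q) u - t * A v\<bar> = \<bar>G t - G 0 - t\<^sup>2 * A v\<bar>"
    proof -
      have "G t - G 0 - t\<^sup>2 * A v = t * (F' (x + ?p) u - F' (x + ?q) u - t * A v)"
        unfolding G by (simp add: power2_eq_square algebra_simps)
      then show ?thesis
        using elim by (simp add: abs_mult)
    qed
    ultimately have "\<bar>G t - G 0 - t\<^sup>2 * A v\<bar> \<le> t\<^sup>2 * (2 * e * K)"
      by (simp add: power2_eq_square algebra_simps)
    moreover have "G t - G 0 = F (x + t *\<^sub>R u + t *\<^sub>R v) - F (x + t *\<^sub>R u) - F (x + t *\<^sub>R v) + F x"
      by (simp add: G_def)
    ultimately show ?case
      by (simp add: K_def)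
  qed
qed

text \<open>The second difference is symmetric in \<open>u\<close> and \<open>v\<close>, while the
  estimate compares it with \<open>t\<^sup>2 * A v\<close> and, after the swap, with
  \<open>t\<^sup>2 * B u\<close>. Second derivatives are thus only taken at \<open>x\<close>, with
  no continuity involved.\<close>

lemma symmetric_second_derivative_real:
  fixes F :: "'a::real_normed_vector \<Rightarrow> real"
  assumes S: "open S" "x \<in> S"
    and F: "\<And>y. y \<in> S \<Longrightarrow> (F has_derivative F' y) (at y)"
    and A: "((\<lambda>y. F' y u) has_derivative A) (at x)"
    and B: "((\<lambda>y. F' y v) has_derivative B) (at x)"
  shows "A v = B u"
proof -
  have est: "\<bar>A v - B u\<bar> \<le> e * (4 * (norm u + norm v))" if e: "e > 0" for e
  proof -
    have "\<forall>\<^sub>F t in at_right (0::real). 0 < t"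
      by (rule eventually_at_right_less)
    moreover have "\<forall>\<^sub>F t in at_right 0.
        \<bar>F (x + t *\<^sub>R u + t *\<^sub>R v) - F (x + t *\<^sub>R u) - F (x + t *\<^sub>R v) + F x - t\<^sup>2 * A v\<bar>
        \<le> t\<^sup>2 * (2 * e * (norm u + norm v))"
      by (rule second_difference_estimate[OF S F A e])
    moreover have "\<forall>\<^sub>F t in at_right 0.
        \<bar>F (x + t *\<^sub>R v + t *\<^sub>R u) - F (x + t *\<^sub>R v) - F (x + t *\<^sub>R u) + F x - t\<^sup>2 * B u\<bar>
        \<le> t\<^sup>2 * (2 * e * (norm v + norm u))"
      by (rule second_difference_estimate[OF S F B e])
    ultimately have "\<forall>\<^sub>F t in at_right (0::real). \<bar>A v - B u\<bar> \<le> e * (4 * (norm u + norm v))"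
    proof eventually_elim
      case (elim t)
      have "x + t *\<^sub>R v + t *\<^sub>R u = x + t *\<^sub>R u + t *\<^sub>R v"
        by simp
      then have "\<bar>t\<^sup>2 * A v - t\<^sup>2 * B u\<bar> \<le> t\<^sup>2 * (2 * e * (norm u + norm v)) + t\<^sup>2 * (2 * e * (norm v + norm u))"
        using elim(2,3) by (smt (verit))
      then have "t\<^sup>2 * \<bar>A v - B u\<bar> \<le> t\<^sup>2 * (e * (4 * (norm u + norm v)))"
      proof -
        have "t\<^sup>2 * \<bar>A v - B u\<bar> = \<bar>t\<^sup>2 * A v - t\<^sup>2 * B u\<bar>"
          by (simp add: abs_mult flip: right_diff_distrib)
        also note \<open>\<dots> \<le> t\<^sup>2 * (2 * e * (norm u + norm v)) + t\<^sup>2 * (2 * e * (norm v + norm u))\<close>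
        finally show ?thesis
          by (simp add: algebra_simps)
      qed
      then show ?case
        using elim(1) by simp
    qed
    then show ?thesis
      by simp
  qed
  define C where "C = 4 * (norm u + norm v) + 1"
  have C: "C > 0"
    by (simp add: C_def add_nonneg_pos)
  have "\<bar>A v - B u\<bar> \<le> 0 + e" if "e > 0" for e
  proof -
    have "\<bar>A v - B u\<bar> \<le> e / C * (4 * (norm u + norm v))"
      using that C by (intro est) simp
    also have "\<dots> \<le> e / C * C"
      using that C by (intro mult_left_mono) (auto simp: C_def)
    finally show ?thesis
      using C by simp
  qed
  then have "\<bar>A v - B u\<bar> \<le> 0"
    by (rule field_le_epsilon)
  then show ?thesis
    by simp
qed

lemma symmetric_second_derivative:
  fixes F :: "'a::real_normed_vector \<Rightarrow> 'b::euclidean_space"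
  assumes S: "open S" "x \<in> S"
    and F: "\<And>y. y \<in> S \<Longrightarrow> (F has_derivative F' y) (at y)"
    and A: "((\<lambda>y. F' y u) has_derivative A) (at x)"
    and B: "((\<lambda>y. F' y v) has_derivative B) (at x)"
  shows "A v = B u"
proof (rule euclidean_eqI)
  fix b :: 'b
  show "A v \<bullet> b = B u \<bullet> b"
    using F A B by (intro symmetric_second_derivative_real[OF S, where F = "\<lambda>y. F y \<bullet> b" and F' = "\<lambda>y h. F' y h \<bullet> b"]
        has_derivative_inner_left)
qed

text \<open>Both sides are the same double sum of matrix entries. It makes the Ricci trace
  independent of coordinates.\<close>

lemma trace_mult_commute:
  fixes P T :: "'e::euclidean_space \<Rightarrow> 'e"
  assumes "linear P" "linear T"
  shows "(\<Sum>b\<in>Basis. P (T b) \<bullet> b) = (\<Sum>b\<in>Basis. T (P b) \<bullet> b)"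
proof -
  have *: "(\<Sum>b\<in>Basis. P (T b) \<bullet> b) = (\<Sum>b\<in>Basis. \<Sum>c\<in>Basis. (T b \<bullet> c) * (P c \<bullet> b))"
    if "linear P" for P T :: "'e \<Rightarrow> 'e"
    by (subst linear_eq_sum_Basis[OF that]) (simp add: inner_sum_left)
  show ?thesis
    unfolding *[OF assms(1)] *[OF assms(2)]
    by (subst sum.swap) (simp add: mult.commute)
qed

section \<open>Curvature of a general connection and its naturality under coordinate maps\<close>

section \<open>Curvature of a connection in coordinates\<close>

text \<open>Despite the name, differentiability at each point is what is recorded; the pointwise
  symmetry of second derivatives fits this regularity.\<close>

definition C1_connection ::
    "'e::euclidean_space set \<Rightarrow> ('e \<Rightarrow> 'e \<Rightarrow> 'e \<Rightarrow> 'e) \<Rightarrow> bool"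
  where "C1_connection S \<Gamma> \<longleftrightarrow>
    (\<forall>x\<in>S. bilinear (\<Gamma> x) \<and> (\<forall>v w. (\<lambda>y. \<Gamma> y v w) differentiable (at x)))"

text \<open>\<open>ricci\<close> is tied to a metric; this trace takes any connection and hence also
  the Weyl connection, which on \<open>M\<close> is not given by a global metric.\<close>

definition ricci_of ::
    "('e::euclidean_space \<Rightarrow> 'e \<Rightarrow> 'e \<Rightarrow> 'e) \<Rightarrow> 'e \<Rightarrow> 'e \<Rightarrow> 'e \<Rightarrow> real"
  where "ricci_of \<Gamma> x v w = (\<Sum>b\<in>Basis. curvature \<Gamma> (\<lambda>_. b) (\<lambda>_. v) (\<lambda>_. w) x \<bullet> b)"

lemma ricci_eq_ricci_of: "ricci g x v w = ricci_of (christoffel g) x v w"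
  by (simp add: ricci_def ricci_of_def)

lemma bilinear_linear1: "bilinear h \<Longrightarrow> linear (\<lambda>v. h v w)"
  by (simp add: bilinear_def)

lemma bilinear_linear2: "bilinear h \<Longrightarrow> linear (h v)"
  by (simp add: bilinear_def)

lemma has_derivative_dir_deriv:
  "F differentiable (at x) \<Longrightarrow> (F has_derivative dir_deriv F x) (at x)"
  by (simp add: frechet_derivative_works)

lemma dir_deriv_eq: "(F has_derivative F') (at x) \<Longrightarrow> dir_deriv F x v = F' v"
  using frechet_derivative_at by metis

lemma linear_dir_deriv: "F differentiable (at x) \<Longrightarrow> linear (dir_deriv F x)"
  using has_derivative_dir_deriv has_derivative_linear by blast

lemma dir_deriv_cong_open:
  assumes "open S" "x \<in> S" "\<And>y. y \<in> S \<Longrightarrow> F y = G y" "F differentiable (at x)"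
  shows "dir_deriv F x v = dir_deriv G x v"
  using frechet_derivative_transform_within_open[OF assms(4,1,2,3)] by simp

lemma differentiable_cong_open:
  assumes "open S" "x \<in> S" "\<And>y. y \<in> S \<Longrightarrow> F y = G y" "F differentiable (at x)"
  shows "G differentiable (at x)"
  using has_derivative_transform_within_open[where f = F and g = G, OF _ assms(1-3)] assms(4) unfolding differentiable_def
  by blast

lemma linear_dir_deriv_parameter:
  assumes S: "open S" "x \<in> S"
    and lin: "\<And>y. y \<in> S \<Longrightarrow> linear (L y)"
    and diff: "\<And>v. (\<lambda>y. L y v) differentiable (at x)"
  shows "linear (\<lambda>v. dir_deriv (\<lambda>y. L y v) x h)"
proof (rule linearI)
  note d = has_derivative_dir_deriv[OF diff]
  fix v w and r :: real
  have "((\<lambda>y. L y (v + w)) has_derivative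
      (\<lambda>h. dir_deriv (\<lambda>y. L y v) x h + dir_deriv (\<lambda>y. L y w) x h)) (at x)"
    by (rule has_derivative_transform_within_open[OF has_derivative_add[OF d d] S])
      (simp add: linear_add[OF lin])
  then show "dir_deriv (\<lambda>y. L y (v + w)) x h =
      dir_deriv (\<lambda>y. L y v) x h + dir_deriv (\<lambda>y. L y w) x h"
    by (rule dir_deriv_eq)
  have "((\<lambda>y. L y (r *\<^sub>R v)) has_derivative (\<lambda>h. r *\<^sub>R dir_deriv (\<lambda>y. L y v) x h)) (at x)"
    by (rule has_derivative_transform_within_open[OF has_derivative_scaleR_right[OF d] S])
      (simp add: linear_scale[OF lin])
  then show "dir_deriv (\<lambda>y. L y (r *\<^sub>R v)) x h = r *\<^sub>R dir_deriv (\<lambda>y. L y v) x h"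
    by (rule dir_deriv_eq)
qed

lemma curvature_constant_fields:
  assumes "bilinear (\<Gamma> x)"
  shows "curvature \<Gamma> (\<lambda>_. u) (\<lambda>_. v) (\<lambda>_. w) x =
    dir_deriv (\<lambda>y. \<Gamma> y v w) x u + \<Gamma> x u (\<Gamma> x v w)
    - (dir_deriv (\<lambda>y. \<Gamma> y u w) x v + \<Gamma> x v (\<Gamma> x u w))"
proof -
  have "cov_deriv \<Gamma> (\<lambda>_. a) (\<lambda>_. b) = (\<lambda>y. \<Gamma> y a b)" for a b
    by (simp add: cov_deriv_def fun_eq_iff)
  then show ?thesis
    using bilinear_lzero[OF assms] by (simp add: curvature_def cov_deriv_def lie_bracket_def)
qed

lemma linear_curvature:
  assumes S: "open S" "x \<in> S" and \<Gamma>: "C1_connection S \<Gamma>"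
  shows "linear (\<lambda>u. curvature \<Gamma> (\<lambda>_. u) (\<lambda>_. v) (\<lambda>_. w) x)"
proof -
  have bil: "bilinear (\<Gamma> y)" and diff: "(\<lambda>y. \<Gamma> y v w) differentiable (at y)" if "y \<in> S" for y v w
    using \<Gamma> that by (auto simp: C1_connection_def)
  note bx = bil[OF S(2)]
  have 1: "linear (\<lambda>u. dir_deriv (\<lambda>y. \<Gamma> y v w) x u)"
    using linear_dir_deriv[OF diff[OF S(2)]] by simp
  have 2: "linear (\<lambda>u. dir_deriv (\<lambda>y. \<Gamma> y u w) x v)"
    using linear_dir_deriv_parameter[OF S, where L = "\<lambda>y u. \<Gamma> y u w"] bil diff S(2)
    by (auto simp: bilinear_def)
  have 3: "linear (\<lambda>u. \<Gamma> x v (\<Gamma> x u w))"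
    using linear_compose[OF bilinear_linear1[OF bx, of w] bilinear_linear2[OF bx, of v]]
    by (simp add: o_def)
  show ?thesis
    unfolding curvature_constant_fields[of \<Gamma>, OF bx]
    by (intro linear_compose_sub linear_compose_add 1 2 3 bilinear_linear1 bx)
qed

text \<open>\<open>E\<close> is the covariant derivative of \<open>X\<close>; equate the mixed second derivatives of \<open>X\<close>.\<close>

lemma curvature_on_field:
  assumes S: "open S" "x \<in> S" and \<Gamma>: "C1_connection S \<Gamma>"
    and X: "\<And>y. y \<in> S \<Longrightarrow> (X has_derivative (\<lambda>u. E y u - \<Gamma> y u (X y))) (at y)"
    and E: "\<And>v. ((\<lambda>y. E y v) has_derivative E' v) (at x)"
  shows "curvature \<Gamma> (\<lambda>_. u) (\<lambda>_. v) (\<lambda>_. X x) x =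
    (E' v u + \<Gamma> x u (E x v)) - (E' u v + \<Gamma> x v (E x u))"
proof -
  have bil: "bilinear (\<Gamma> y)" and diff: "(\<lambda>y. \<Gamma> y v w) differentiable (at y)" if "y \<in> S" for y v w
    using \<Gamma> that by (auto simp: C1_connection_def)
  note bx = bil[OF S(2)]
  have d: "((\<lambda>y. E y u - \<Gamma> y u (X y)) has_derivative
      (\<lambda>h. E' u h - (dir_deriv (\<lambda>y. \<Gamma> y u (X x)) x h + \<Gamma> x u (E x h - \<Gamma> x h (X x))))) (at x)" for u
    by (intro has_derivative_diff E has_derivative_linear_field[OF S, where L = "\<lambda>y. \<Gamma> y u"]
        has_derivative_dir_deriv diff[OF S(2)] X[OF S(2)]) (simp add: bilinear_linear2 bil)
  have "E' u v - (dir_deriv (\<lambda>y. \<Gamma> y u (X x)) x v + \<Gamma> x u (E x v - \<Gamma> x v (X x))) =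
      E' v u - (dir_deriv (\<lambda>y. \<Gamma> y v (X x)) x u + \<Gamma> x v (E x u - \<Gamma> x u (X x)))"
    by (rule symmetric_second_derivative[OF S X d d])
  then show ?thesis
    unfolding curvature_constant_fields[of \<Gamma>, OF bx]
    by (simp add: bilinear_rsub[OF bx] algebra_simps)
qed

text \<open>The hypothesis on \<open>\<Gamma>\<close> is the transformation law of Christoffel
  symbols: \<open>\<phi>\<close> carries \<open>\<Gamma>\<close> to \<open>D\<close>, and
  \<open>\<phi>2 y w v\<close> is the derivative of \<open>\<phi>1 _ w\<close> along
  \<open>v\<close>. Differentiating the law shows that curvature is natural, as the second and third
  derivatives of \<open>\<phi>\<close> are symmetric and cancel; the Ricci tensor follows because
  conjugation by \<open>\<phi>1 x\<close> preserves the trace.\<close>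

lemma pullback_connection:
  fixes \<phi> :: "'e::euclidean_space \<Rightarrow> 'e"
  assumes S: "open S" and W: "open W" and \<phi>S: "\<And>y. y \<in> W \<Longrightarrow> \<phi> y \<in> S"
    and D: "C1_connection S D"
    and \<phi>1: "\<And>y. y \<in> W \<Longrightarrow> (\<phi> has_derivative \<phi>1 y) (at y)"
    and \<phi>2: "\<And>y v. y \<in> W \<Longrightarrow> ((\<lambda>z. \<phi>1 z v) has_derivative \<phi>2 y v) (at y)"
    and \<phi>3: "\<And>y v w. y \<in> W \<Longrightarrow> (\<lambda>z. \<phi>2 z w v) differentiable (at y)"
    and inj: "\<And>y. y \<in> W \<Longrightarrow> inj (\<phi>1 y)"
    and \<Gamma>: "\<And>y v w. y \<in> W \<Longrightarrow>
      \<phi>1 y (\<Gamma> y v w) = D (\<phi> y) (\<phi>1 y v) (\<phi>1 y w) + \<phi>2 y w v"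
  shows C1_connection_pullback: "C1_connection W \<Gamma>"
    and curvature_pullback: "x \<in> W \<Longrightarrow> \<phi>1 x (curvature \<Gamma> (\<lambda>_. u) (\<lambda>_. v) (\<lambda>_. w) x) =
      curvature D (\<lambda>_. \<phi>1 x u) (\<lambda>_. \<phi>1 x v) (\<lambda>_. \<phi>1 x w) (\<phi> x)"
    and ricci_of_pullback: "x \<in> W \<Longrightarrow> ricci_of \<Gamma> x v w = ricci_of D (\<phi> x) (\<phi>1 x v) (\<phi>1 x w)"
proof -
  have bil: "bilinear (D p)" and diff: "(\<lambda>p. D p v w) differentiable (at p)" if "p \<in> S" for p v w
    using D that by (auto simp: C1_connection_def)
  have lin1: "linear (\<phi>1 y)" and lin2: "linear (\<phi>2 y w)" if "y \<in> W" for y w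
    using \<phi>1 \<phi>2 that has_derivative_linear by blast+
  have sym2: "\<phi>2 y v w = \<phi>2 y w v" if "y \<in> W" for y v w
    by (rule symmetric_second_derivative[OF W that \<phi>1 \<phi>2[OF that] \<phi>2[OF that]])
  have bil\<Gamma>: "bilinear (\<Gamma> y)" if y: "y \<in> W" for y
    unfolding bilinear_def
  proof (intro conjI allI linearI)
    note by' = bil[OF \<phi>S[OF y]]
    note simps = \<Gamma>[OF y] linear_add[OF lin1[OF y]] linear_scale[OF lin1[OF y]]
      bilinear_ladd[OF by'] bilinear_radd[OF by'] bilinear_lmul[OF by'] bilinear_rmul[OF by']
    fix a b c and r :: real
    show "\<Gamma> y a (b + c) = \<Gamma> y a b + \<Gamma> y a c"
      by (rule injD[OF inj[OF y]])
        (simp add: simps sym2[OF y, of _ a] linear_add[OF lin2[OF y]])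
    show "\<Gamma> y a (r *\<^sub>R b) = r *\<^sub>R \<Gamma> y a b"
      by (rule injD[OF inj[OF y]])
        (simp add: simps sym2[OF y, of _ a] linear_scale[OF lin2[OF y]] scaleR_right_distrib)
    show "\<Gamma> y (b + c) a = \<Gamma> y b a + \<Gamma> y c a"
      by (rule injD[OF inj[OF y]]) (simp add: simps linear_add[OF lin2[OF y]])
    show "\<Gamma> y (r *\<^sub>R b) a = r *\<^sub>R \<Gamma> y b a"
      by (rule injD[OF inj[OF y]]) (simp add: simps linear_scale[OF lin2[OF y]] scaleR_right_distrib)
  qed
  define \<phi>3 where "\<phi>3 y w v = dir_deriv (\<lambda>z. \<phi>2 z w v) y" for y w v
  have \<phi>3: "((\<lambda>z. \<phi>2 z w v) has_derivative \<phi>3 y w v) (at y)" if "y \<in> W" for y v w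
    unfolding \<phi>3_def by (rule has_derivative_dir_deriv[OF \<phi>3[OF that]])
  have sym3: "\<phi>3 y w u v = \<phi>3 y w v u" if "y \<in> W" for y u v w
    by (rule symmetric_second_derivative[OF W that \<phi>2 \<phi>3[OF that] \<phi>3[OF that]])
  define dD where "dD y v w = dir_deriv (\<lambda>p. D p v w) (\<phi> y)" for y v w
  have dD: "((\<lambda>z. D (\<phi> z) v w) has_derivative (\<lambda>h. dD y v w (\<phi>1 y h))) (at y)" if "y \<in> W" for y v w
    unfolding dD_def
    by (rule has_derivative_compose[OF \<phi>1[OF that] has_derivative_dir_deriv[OF diff[OF \<phi>S[OF that]]]])
  have rhs: "((\<lambda>z. \<phi>1 z (\<Gamma> z v w)) has_derivative
      (\<lambda>h. dD y (\<phi>1 y v) (\<phi>1 y w) (\<phi>1 y h) + D (\<phi> y) (\<phi>2 y v h) (\<phi>1 y w)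
        + D (\<phi> y) (\<phi>1 y v) (\<phi>2 y w h) + \<phi>3 y w v h)) (at y)" if y: "y \<in> W" for y v w
  proof -
    have "((\<lambda>z. D (\<phi> z) (\<phi>1 z v) (\<phi>1 z w) + \<phi>2 z w v) has_derivative
      (\<lambda>h. dD y (\<phi>1 y v) (\<phi>1 y w) (\<phi>1 y h) + D (\<phi> y) (\<phi>2 y v h) (\<phi>1 y w)
        + D (\<phi> y) (\<phi>1 y v) (\<phi>2 y w h) + \<phi>3 y w v h)) (at y)"
      by (intro has_derivative_add \<phi>3[OF y] \<phi>2[OF y] bil \<phi>S dD[OF y]
          has_derivative_bilinear_field[OF W y, where L = "\<lambda>z. D (\<phi> z)"
            and L' = "\<lambda>a b h. dD y a b (\<phi>1 y h)"])
    then show ?thesis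
      by (rule has_derivative_transform_within_open[OF _ W y]) (simp add: \<Gamma>)
  qed
  \<comment> \<open>The law is a linear system for \<open>\<Gamma> z v w\<close> with injective
    coefficient \<open>\<phi>1 z\<close> and differentiable right side.\<close>
  have diff\<Gamma>: "(\<lambda>z. \<Gamma> z v w) differentiable (at y)" if y: "y \<in> W" for y v w
  proof (rule linear_solution_differentiable[OF W y, where L = \<phi>1])
    show "linear (\<phi>1 z)" if "z \<in> W" for z
      by (rule lin1[OF that])
    show "(\<lambda>z. \<phi>1 z a) differentiable (at y)" for a
      using \<phi>2[OF y] unfolding differentiable_def by blast
    show "inj (\<phi>1 y)"
      by (rule inj[OF y])
    show "(\<lambda>z. \<phi>1 z (\<Gamma> z v w)) differentiable (at y)"
      using rhs[OF y] unfolding differentiable_def by blast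
  qed
  show C1: "C1_connection W \<Gamma>"
    using bil\<Gamma> diff\<Gamma> by (simp add: C1_connection_def)
  show curv: "\<phi>1 x (curvature \<Gamma> (\<lambda>_. u) (\<lambda>_. v) (\<lambda>_. w) x) =
      curvature D (\<lambda>_. \<phi>1 x u) (\<lambda>_. \<phi>1 x v) (\<lambda>_. \<phi>1 x w) (\<phi> x)" if x: "x \<in> W" for x u v w
  proof -
    note bx = bil[OF \<phi>S[OF x]]
    have "((\<lambda>z. \<phi>1 z (\<Gamma> z v w)) has_derivative
        (\<lambda>h. \<phi>2 x (\<Gamma> x v w) h + \<phi>1 x (dir_deriv (\<lambda>z. \<Gamma> z v w) x h))) (at x)" for v w
      by (intro has_derivative_linear_field[OF W x] lin1 \<phi>2[OF x]
          has_derivative_dir_deriv diff\<Gamma>[OF x])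
    \<comment> \<open>The two sides of the transformation law are differentiated separately;
      comparison isolates the derivative of \<open>\<Gamma>\<close>.\<close>
    from has_derivative_unique[OF this rhs[OF x]]
    have dG: "\<phi>1 x (dir_deriv (\<lambda>z. \<Gamma> z v w) x h) =
        dD x (\<phi>1 x v) (\<phi>1 x w) (\<phi>1 x h) + D (\<phi> x) (\<phi>2 x v h) (\<phi>1 x w)
        + D (\<phi> x) (\<phi>1 x v) (\<phi>2 x w h) + \<phi>3 x w v h - \<phi>2 x (\<Gamma> x v w) h" for v w h
      by (metis add_diff_cancel_left')
    have GG: "\<phi>1 x (\<Gamma> x u (\<Gamma> x v w)) = D (\<phi> x) (\<phi>1 x u) (D (\<phi> x) (\<phi>1 x v) (\<phi>1 x w))
        + D (\<phi> x) (\<phi>1 x u) (\<phi>2 x w v) + \<phi>2 x (\<Gamma> x v w) u" for u v w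
      by (simp add: \<Gamma>[OF x] bilinear_radd[OF bx])
    show ?thesis
      unfolding curvature_constant_fields[of \<Gamma>, OF bil\<Gamma>[OF x]] curvature_constant_fields[of D, OF bx]
      by (simp add: linear_diff[OF lin1[OF x]] linear_add[OF lin1[OF x]] dG GG
          sym2[OF x, of u v] sym3[OF x, of w u v] flip: dD_def)
  qed
  show "ricci_of \<Gamma> x v w = ricci_of D (\<phi> x) (\<phi>1 x v) (\<phi>1 x w)" if x: "x \<in> W" for x v w
  proof -
    define T where "T u = curvature D (\<lambda>_. u) (\<lambda>_. \<phi>1 x v) (\<lambda>_. \<phi>1 x w) (\<phi> x)" for u
    have linT: "linear T"
      unfolding T_def by (rule linear_curvature[OF S \<phi>S[OF x] D])
    \<comment> \<open>\<open>P\<close> inverts \<open>\<phi>1 x\<close>, so the curvature of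
      \<open>\<Gamma>\<close> is \<open>P\<close> after \<open>T\<close> after
      \<open>\<phi>1 x\<close>, with the trace of \<open>T\<close>.\<close>
    obtain P where P: "linear P" "\<And>a. P (\<phi>1 x a) = a" "\<And>a. \<phi>1 x (P a) = a"
      using linear_injective_isomorphism[OF lin1[OF x] inj[OF x]] by blast
    have "ricci_of \<Gamma> x v w = (\<Sum>b\<in>Basis. P (T (\<phi>1 x b)) \<bullet> b)"
      unfolding ricci_of_def T_def curv[OF x, symmetric] P(2) ..
    also have "\<dots> = (\<Sum>b\<in>Basis. T (\<phi>1 x (P b)) \<bullet> b)"
      using trace_mult_commute[OF P(1) linear_compose[OF lin1[OF x] linT]] by simp
    finally show ?thesis
      by (simp add: P(3) ricci_of_def T_def)
  qed
qed

section \<open>Existence and regularity of the Levi-Civita connection in a chart\<close>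

section \<open>Riemannian metrics in coordinates\<close>

lemma posdef_eqI:
  fixes h :: "'e::real_vector \<Rightarrow> 'e \<Rightarrow> real"
  assumes h: "bilinear h" and pos: "\<And>v. v \<noteq> 0 \<Longrightarrow> h v v > 0"
    and eq: "\<And>u. h a u = h b u"
  shows "a = b"
proof (rule ccontr)
  assume "a \<noteq> b"
  then have "h (a - b) (a - b) > 0"
    by (intro pos) simp
  then show False
    by (simp add: bilinear_lsub[OF h] eq)
qed

lemma inner_sum_Basis_linear:
  fixes L :: "'e::euclidean_space \<Rightarrow> real"
  assumes "linear L"
  shows "(\<Sum>b\<in>Basis. L b *\<^sub>R b) \<bullet> u = L u"
  using linear_eq_sum_Basis[OF assms, of u]
  by (simp add: inner_sum_left inner_commute[of u] mult.commute)

text \<open>Finite-dimensional Riesz representation: lowering an index is injective by definiteness,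
  hence onto.\<close>

lemma posdef_representation:
  fixes h :: "'e::euclidean_space \<Rightarrow> 'e \<Rightarrow> real"
  assumes h: "bilinear h" and pos: "\<And>v. v \<noteq> 0 \<Longrightarrow> h v v > 0" and L: "linear L"
  obtains z where "\<And>u. h z u = L u"
proof -
  define T where "T z = (\<Sum>b\<in>Basis. h z b *\<^sub>R b)" for z
  have T: "T z \<bullet> u = h z u" for z u
    unfolding T_def by (rule inner_sum_Basis_linear[OF bilinear_linear2[OF h]])
  have "linear T"
    by (rule linearI; rule euclidean_eqI) (simp_all add: T inner_left_distrib bilinear_ladd[OF h] bilinear_lmul[OF h])
  moreover have "inj T"
    by (rule injI, rule posdef_eqI[OF h pos]) (simp_all flip: T)
  ultimately have "surj T"
    by (rule linear_injective_imp_surjective) simp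
  then obtain z where z: "T z = (\<Sum>b\<in>Basis. L b *\<^sub>R b)"
    by (metis surjD)
  have "h z u = L u" for u
    by (simp add: T[symmetric] z inner_sum_Basis_linear[OF L])
  then show thesis
    by (rule that)
qed

lemma christoffel_eqI:
  assumes h: "bilinear (g x)" and pos: "\<And>v. v \<noteq> 0 \<Longrightarrow> g x v v > 0"
    and z: "\<And>u. 2 * g x z u =
      dir_deriv (\<lambda>y. g y w u) x v + dir_deriv (\<lambda>y. g y v u) x w - dir_deriv (\<lambda>y. g y v w) x u"
  shows "christoffel g x v w = z"
  unfolding christoffel_def
proof (rule the_equality)
  fix z' assume "\<forall>u. 2 * g x z' u =
      dir_deriv (\<lambda>y. g y w u) x v + dir_deriv (\<lambda>y. g y v u) x w - dir_deriv (\<lambda>y. g y v w) x u"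
  then have "2 * g x z' u = 2 * g x z u" for u
    by (simp only: z)
  then have "g x z' u = g x z u" for u
    by simp
  then show "z' = z"
    using posdef_eqI[where h = "g x", OF h pos] by blast
qed (simp add: z)

text \<open>Two pointwise derivatives of the metric are assumed, which makes its Christoffel symbols
  differentiable.\<close>

locale metric_chart =
  fixes S :: "'e::euclidean_space set" and g :: "'e \<Rightarrow> 'e \<Rightarrow> 'e \<Rightarrow> real"
  assumes S: "open S"
    and g_bil: "x \<in> S \<Longrightarrow> bilinear (g x)"
    and g_sym: "x \<in> S \<Longrightarrow> g x v w = g x w v"
    and g_pos: "x \<in> S \<Longrightarrow> v \<noteq> 0 \<Longrightarrow> g x v v > 0"
    and g_diff: "x \<in> S \<Longrightarrow> (\<lambda>y. g y v w) differentiable (at x)"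
    and g_diff2: "x \<in> S \<Longrightarrow> (\<lambda>y. dir_deriv (\<lambda>y. g y v w) y u) differentiable (at x)"
begin

abbreviation "\<Gamma> \<equiv> christoffel g"
abbreviation "dg x v w \<equiv> dir_deriv (\<lambda>y. g y v w) x"

lemma g_eqI: "x \<in> S \<Longrightarrow> (\<And>u. g x a u = g x b u) \<Longrightarrow> a = b"
  using posdef_eqI[OF g_bil g_pos] by blast

lemma dg_linear: "x \<in> S \<Longrightarrow> linear (dg x v w)"
  by (rule linear_dir_deriv[OF g_diff])

lemma dg_sym: assumes "x \<in> S" shows "dg x v w u = dg x w v u"
  by (rule dir_deriv_cong_open[OF S assms g_sym g_diff[OF assms]])

lemma dg_linear2: "x \<in> S \<Longrightarrow> linear (\<lambda>w. dg x v w u)"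
  using linear_dir_deriv_parameter[OF S, where L = "\<lambda>y. g y v"] g_bil g_diff
  by (auto simp: bilinear_def)

lemma dg_linear1: assumes x: "x \<in> S" shows "linear (\<lambda>v. dg x v w u)"
proof -
  have "(\<lambda>v. dg x v w u) = (\<lambda>v. dg x w v u)"
    by (rule ext) (rule dg_sym[OF x])
  then show ?thesis
    using dg_linear2[OF x, of w u] by simp
qed

text \<open>The right side is linear in \<open>u\<close>, so it is represented by a vector; this is
  the one that \<open>THE\<close> in \<open>christoffel\<close> picks.\<close>

lemma koszul:
  assumes x: "x \<in> S"
  shows "2 * g x (\<Gamma> x v w) u = dg x w u v + dg x v u w - dg x v w u"
proof -
  have "linear (\<lambda>u. dg x w u v + dg x v u w - dg x v w u)"
    by (intro linear_compose_sub linear_compose_add dg_linear2 dg_linear x)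
  from linear_compose_scale_right[OF this, of "1/2"]
  have "linear (\<lambda>u. (dg x w u v + dg x v u w - dg x v w u) / 2)"
    by simp
  then obtain z where z0: "\<And>u. g x z u = (dg x w u v + dg x v u w - dg x v w u) / 2"
    using posdef_representation[OF g_bil[OF x] g_pos[OF x]] by blast
  have z: "2 * g x z u = dg x w u v + dg x v u w - dg x v w u" for u
    by (simp add: z0)
  then have "\<Gamma> x v w = z"
    by (intro christoffel_eqI g_bil[OF x] g_pos[OF x])
  then show ?thesis
    by (simp only: z)
qed

lemma \<Gamma>_sym: assumes x: "x \<in> S" shows "\<Gamma> x v w = \<Gamma> x w v"
proof (rule g_eqI[OF x])
  show "g x (\<Gamma> x v w) u = g x (\<Gamma> x w v) u" for u
    using koszul[OF x, of v w u] koszul[OF x, of w v u] dg_sym[OF x, of v w u] by linarith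
qed

text \<open>Metric compatibility of the Levi-Civita connection: add the Koszul formulas for
  \<open>(u, v, w)\<close> and \<open>(u, w, v)\<close>.\<close>

lemma dg_eq:
  assumes x: "x \<in> S"
  shows "dg x v w u = g x (\<Gamma> x u v) w + g x v (\<Gamma> x u w)"
  using koszul[OF x, of u v w] koszul[OF x, of u w v] dg_sym[OF x, of v w u]
    dg_sym[OF x, of u w v] dg_sym[OF x, of u v w] g_sym[OF x, of v "\<Gamma> x u w"] by linarith

lemma \<Gamma>_bilinear: assumes x: "x \<in> S" shows "bilinear (\<Gamma> x)"
proof -
  have "linear (\<Gamma> x a)" for a
  proof (rule linearI; rule g_eqI[OF x])
    fix b c u and r :: real
    note simps = linear_add[OF dg_linear1[OF x]] linear_add[OF dg_linear2[OF x]] linear_add[OF dg_linear[OF x]]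
      linear_scale[OF dg_linear1[OF x]] linear_scale[OF dg_linear2[OF x]] linear_scale[OF dg_linear[OF x]]
    show "g x (\<Gamma> x a (b + c)) u = g x (\<Gamma> x a b + \<Gamma> x a c) u"
      using koszul[OF x, of a "b + c" u] koszul[OF x, of a b u] koszul[OF x, of a c u]
      by (simp add: simps bilinear_ladd[OF g_bil[OF x]])
    have "2 * g x (\<Gamma> x a (r *\<^sub>R b)) u = r * (2 * g x (\<Gamma> x a b) u)"
      unfolding koszul[OF x] by (simp add: simps algebra_simps)
    then show "g x (\<Gamma> x a (r *\<^sub>R b)) u = g x (r *\<^sub>R \<Gamma> x a b) u"
      by (simp add: bilinear_lmul[OF g_bil[OF x]])
  qed
  then show ?thesis
    using \<Gamma>_sym[OF x] by (simp add: bilinear_def)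
qed

text \<open>Raising an index preserves differentiability: \<open>z\<close> solves a linear system
  whose matrix is the metric. Applied to the Christoffel symbols and to \<open>U\<close>.\<close>

lemma solution_differentiable:
  assumes x: "x \<in> S" and z: "\<And>u. (\<lambda>y. g y (z y) u) differentiable (at x)"
  shows "z differentiable (at x)"
proof (rule linear_solution_differentiable[OF S x, where L = "\<lambda>y v. \<Sum>b\<in>Basis. g y v b *\<^sub>R b"])
  show "linear (\<lambda>v. \<Sum>b\<in>Basis. g y v b *\<^sub>R b)" if "y \<in> S" for y
    by (intro linearI)
      (simp_all add: bilinear_ladd[OF g_bil[OF that]] bilinear_lmul[OF g_bil[OF that]]
        scaleR_left_distrib sum.distrib scaleR_sum_right)
  show "(\<lambda>y. \<Sum>b\<in>Basis. g y v b *\<^sub>R b) differentiable (at x)" for v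
    by (intro differentiable_sum differentiable_scaleR differentiable_const g_diff x ballI) simp
  show "(\<lambda>y. \<Sum>b\<in>Basis. g y (z y) b *\<^sub>R b) differentiable (at x)"
    by (intro differentiable_sum differentiable_scaleR differentiable_const z ballI) simp
  show "inj (\<lambda>v. \<Sum>b\<in>Basis. g x v b *\<^sub>R b)"
  proof (rule injI, rule g_eqI[OF x])
    fix v w u
    assume eq: "(\<Sum>b\<in>Basis. g x v b *\<^sub>R b) = (\<Sum>b\<in>Basis. g x w b *\<^sub>R b)"
    have "g x a u = (\<Sum>b\<in>Basis. g x a b *\<^sub>R b) \<bullet> u" for a
      by (rule inner_sum_Basis_linear[symmetric, OF bilinear_linear2[OF g_bil[OF x]]])
    then show "g x v u = g x w u"
      by (simp only: eq)
  qed
qed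

lemma \<Gamma>_differentiable: assumes x: "x \<in> S" shows "(\<lambda>y. \<Gamma> y v w) differentiable (at x)"
proof (rule solution_differentiable[OF x])
  fix u
  have "(\<lambda>y. (1/2) *\<^sub>R (dg y w u v + dg y v u w - dg y v w u)) differentiable (at x)"
    by (intro differentiable_scaleR differentiable_const differentiable_diff differentiable_add g_diff2 x)
  then show "(\<lambda>y. g y (\<Gamma> y v w) u) differentiable (at x)"
    by (rule differentiable_cong_open[OF S x, rotated]) (simp flip: koszul)
qed

lemma \<Gamma>_C1: "C1_connection S \<Gamma>"
  using \<Gamma>_bilinear \<Gamma>_differentiable by (simp add: C1_connection_def)

end

section \<open>Curvature of the Weyl connection for a parallel Lee form of norm one\<close>

section \<open>Unit parallel forms and the Weyl connection\<close>

locale lee_chart = metric_chart S g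
  for S :: "'e::euclidean_space set" and g +
  fixes \<theta> :: "'e \<Rightarrow> 'e \<Rightarrow> real"
  assumes \<theta>_lin: "x \<in> S \<Longrightarrow> linear (\<theta> x)"
    and \<theta>_diff: "x \<in> S \<Longrightarrow> (\<lambda>y. \<theta> y v) differentiable (at x)"
    and \<theta>_parallel: "x \<in> S \<Longrightarrow> cov_deriv_one_form (christoffel g) \<theta> x v w = 0"
    and \<theta>_norm: "x \<in> S \<Longrightarrow> one_form_norm g \<theta> x = 1"
begin

abbreviation "U \<equiv> sharp g \<theta>"

text \<open>These are the Christoffel symbols of \<open>exp (- f) * g\<close> for any local
  \<open>f\<close> with \<open>df = \<theta>\<close>, expressed without \<open>f\<close>.\<close>

definition weyl :: "'e \<Rightarrow> 'e \<Rightarrow> 'e \<Rightarrow> 'e"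
  where "weyl x v w = \<Gamma> x v w - (1/2) *\<^sub>R (\<theta> x v *\<^sub>R w + \<theta> x w *\<^sub>R v - g x v w *\<^sub>R U x)"

lemma d\<theta>: "x \<in> S \<Longrightarrow> ((\<lambda>y. \<theta> y w) has_derivative (\<lambda>v. \<theta> x (\<Gamma> x v w))) (at x)"
proof -
  assume x: "x \<in> S"
  have "dir_deriv (\<lambda>y. \<theta> y w) x v = \<theta> x (\<Gamma> x v w)" for v
    using \<theta>_parallel[OF x, of v w] by (simp add: cov_deriv_one_form_def cov_deriv_def)
  then show ?thesis
    by (intro has_derivative_eq_rhs[OF has_derivative_dir_deriv[OF \<theta>_diff[OF x]]]) (simp add: fun_eq_iff)
qed

lemma dg: "x \<in> S \<Longrightarrow> ((\<lambda>y. g y v w) has_derivative (\<lambda>u. g x (\<Gamma> x u v) w + g x v (\<Gamma> x u w))) (at x)"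
  by (rule has_derivative_eq_rhs[OF has_derivative_dir_deriv[OF g_diff]]) (auto simp: fun_eq_iff dg_eq)

lemma d\<Gamma>: "x \<in> S \<Longrightarrow> ((\<lambda>y. \<Gamma> y v w) has_derivative dir_deriv (\<lambda>y. \<Gamma> y v w) x) (at x)"
  by (rule has_derivative_dir_deriv[OF \<Gamma>_differentiable])

lemma g_U: assumes x: "x \<in> S" shows "g x (U x) v = \<theta> x v"
proof -
  obtain z where z: "\<And>u. g x z u = \<theta> x u"
    using posdef_representation[OF g_bil[OF x] g_pos[OF x] \<theta>_lin[OF x]] by blast
  have "U x = z"
    unfolding sharp_def by (rule the_equality) (auto simp: z intro: g_eqI[OF x])
  then show ?thesis
    using z by simp
qed

lemma g_U': "x \<in> S \<Longrightarrow> g x v (U x) = \<theta> x v"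
  using g_U g_sym by metis

lemma \<theta>_U: assumes x: "x \<in> S" shows "\<theta> x (U x) = 1"
  using \<theta>_norm[OF x] g_U[OF x, of "U x"] by (simp add: one_form_norm_def)

text \<open>\<open>U\<close> inherits parallelism from \<open>\<theta>\<close>: differentiate
  \<open>g(U, w) = \<theta>(w)\<close> and cancel the terms coming from metric
  compatibility.\<close>

lemma dU: assumes x: "x \<in> S" shows "(U has_derivative (\<lambda>v. - \<Gamma> x v (U x))) (at x)"
proof -
  have "U differentiable (at x)"
  proof (rule solution_differentiable[OF x])
    show "(\<lambda>y. g y (U y) u) differentiable (at x)" for u
      by (rule differentiable_cong_open[OF S x _ \<theta>_diff[OF x]]) (simp add: g_U)
  qed
  then have d: "(U has_derivative dir_deriv U x) (at x)"
    by (rule has_derivative_dir_deriv)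
  have "dir_deriv U x v = - \<Gamma> x v (U x)" for v
  proof (rule g_eqI[OF x])
    fix w
    have "((\<lambda>y. g y (U y) w) has_derivative
        (\<lambda>v. (g x (\<Gamma> x v (U x)) w + g x (U x) (\<Gamma> x v w)) + g x (dir_deriv U x v) w)) (at x)"
      using g_bil by (intro has_derivative_linear_field[OF S x, where L = "\<lambda>y v. g y v w"] dg x d)
        (simp add: bilinear_linear1)
    then have "((\<lambda>y. \<theta> y w) has_derivative
        (\<lambda>v. (g x (\<Gamma> x v (U x)) w + g x (U x) (\<Gamma> x v w)) + g x (dir_deriv U x v) w)) (at x)"
      by (rule has_derivative_transform_within_open[OF _ S x]) (simp add: g_U)
    from has_derivative_unique[OF this d\<theta>[OF x]]
    have "(g x (\<Gamma> x v (U x)) w + \<theta> x (\<Gamma> x v w)) + g x (dir_deriv U x v) w = \<theta> x (\<Gamma> x v w)"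
      by (metis g_U[OF x])
    then show "g x (dir_deriv U x v) w = g x (- \<Gamma> x v (U x)) w"
      by (simp add: bilinear_lneg[OF g_bil[OF x]])
  qed
  then show ?thesis
    by (intro has_derivative_eq_rhs[OF d]) (simp add: fun_eq_iff)
qed

lemmas g_simps = bilinear_ladd[OF g_bil] bilinear_radd[OF g_bil] bilinear_lsub[OF g_bil]
  bilinear_rsub[OF g_bil] bilinear_lmul[OF g_bil] bilinear_rmul[OF g_bil]
  bilinear_lneg[OF g_bil] bilinear_rneg[OF g_bil]

lemmas \<theta>_simps = linear_add[OF \<theta>_lin] linear_diff[OF \<theta>_lin] linear_scale[OF \<theta>_lin] linear_neg[OF \<theta>_lin]

lemmas \<Gamma>_simps = bilinear_ladd[OF \<Gamma>_bilinear] bilinear_radd[OF \<Gamma>_bilinear]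
  bilinear_lsub[OF \<Gamma>_bilinear] bilinear_rsub[OF \<Gamma>_bilinear] bilinear_lmul[OF \<Gamma>_bilinear]
  bilinear_rmul[OF \<Gamma>_bilinear] bilinear_lneg[OF \<Gamma>_bilinear] bilinear_rneg[OF \<Gamma>_bilinear]

lemma weyl_sym: "x \<in> S \<Longrightarrow> weyl x v w = weyl x w v"
  using \<Gamma>_sym[of x v w] g_sym[of x v w] by (simp add: weyl_def)

lemma weyl_bilinear: assumes x: "x \<in> S" shows "bilinear (weyl x)"
proof -
  have "linear (weyl x a)" for a
    by (rule linearI)
      (simp_all add: weyl_def g_simps[OF x] \<theta>_simps[OF x] \<Gamma>_simps[OF x] algebra_simps)
  then show ?thesis
    using weyl_sym[OF x] by (simp add: bilinear_def)
qed

lemma dweyl: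
  assumes x: "x \<in> S"
  shows "((\<lambda>y. weyl y v w) has_derivative (\<lambda>h. dir_deriv (\<lambda>y. \<Gamma> y v w) x h
    - (1/2) *\<^sub>R (\<theta> x (\<Gamma> x h v) *\<^sub>R w + \<theta> x (\<Gamma> x h w) *\<^sub>R v
        - (g x v w *\<^sub>R (- \<Gamma> x h (U x)) + (g x (\<Gamma> x h v) w + g x v (\<Gamma> x h w)) *\<^sub>R U x)))) (at x)"
  unfolding weyl_def
  by (intro has_derivative_diff has_derivative_add has_derivative_scaleR_right has_derivative_scaleR_left
      has_derivative_scaleR d\<theta> d\<Gamma> dg dU x)

lemma weyl_C1: "C1_connection S weyl"
  using weyl_bilinear dweyl unfolding C1_connection_def differentiable_def by blast

text \<open>In the conformal change of curvature the covariant derivatives of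
  \<open>\<theta>\<close> and \<open>U\<close> vanish; there remain the terms quadratic in
  \<open>weyl - \<Gamma>\<close>, evaluated with \<open>\<theta>(U) = 1\<close>.\<close>

lemma curvature_weyl:
  assumes x: "x \<in> S"
  shows "curvature weyl (\<lambda>_. u) (\<lambda>_. v) (\<lambda>_. w) x = curvature \<Gamma> (\<lambda>_. u) (\<lambda>_. v) (\<lambda>_. w) x
    + (1/4) *\<^sub>R ((\<theta> x v * \<theta> x w - g x v w) *\<^sub>R u - (\<theta> x u * \<theta> x w - g x u w) *\<^sub>R v
      + (\<theta> x u * g x v w - \<theta> x v * g x u w) *\<^sub>R U x)"
\<comment> \<open>Pairing with \<open>t\<close> turns the vector identity into a polynomial identity
  between real numbers.\<close>
proof (rule g_eqI[OF x])
  fix t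
  show "g x (curvature weyl (\<lambda>_. u) (\<lambda>_. v) (\<lambda>_. w) x) t =
    g x (curvature \<Gamma> (\<lambda>_. u) (\<lambda>_. v) (\<lambda>_. w) x
      + (1/4) *\<^sub>R ((\<theta> x v * \<theta> x w - g x v w) *\<^sub>R u - (\<theta> x u * \<theta> x w - g x u w) *\<^sub>R v
        + (\<theta> x u * g x v w - \<theta> x v * g x u w) *\<^sub>R U x)) t"
    unfolding curvature_constant_fields[of \<Gamma>, OF \<Gamma>_bilinear[OF x]]
      curvature_constant_fields[of weyl, OF weyl_bilinear[OF x]] dir_deriv_eq[OF dweyl[OF x]]
    by (simp add: weyl_def g_simps[OF x] \<theta>_simps[OF x] \<Gamma>_simps[OF x] g_U[OF x] g_U'[OF x] \<theta>_U[OF x]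
        \<Gamma>_sym[OF x, of v u] g_sym[OF x, of v u] g_sym[OF x, of u "\<Gamma> x v w"] g_sym[OF x, of v "\<Gamma> x u w"])
      (simp add: field_simps)
qed

text \<open>Trace \<open>curvature_weyl\<close> over \<open>u\<close>, writing \<open>c\<close> for
  \<open>\<theta>(v) \<theta>(w) - g(v, w)\<close>: the multiple of the identity contributes
  \<open>DIM('e)\<close> copies of \<open>c / 4\<close>, and each of the other two terms takes one
  copy away.\<close>

lemma ricci_weyl:
  assumes x: "x \<in> S"
  shows "ricci_of weyl x v w = ricci g x v w
    + (real DIM('e) - 2) / 4 * (\<theta> x v * \<theta> x w - g x v w)"
proof -
  \<comment> \<open>The basis sums are traces of the rank-one maps sending \<open>b\<close> to
    \<open>\<theta>(b) a\<close> and to \<open>g(b, w) a\<close>.\<close>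
  have 1: "(\<Sum>b\<in>Basis. \<theta> x b * (a \<bullet> b)) = \<theta> x a" for a
    using linear_eq_sum_Basis[OF \<theta>_lin[OF x], of a] by (simp add: mult.commute)
  have 2: "(\<Sum>b\<in>Basis. g x b w * (a \<bullet> b)) = g x a w" for a
    using linear_eq_sum_Basis[OF bilinear_linear1[OF g_bil[OF x]], where v = a]
    by (simp add: mult.commute)
  have "ricci_of weyl x v w = ricci g x v w + (\<Sum>b\<in>Basis.
      (1/4) * ((\<theta> x v * \<theta> x w - g x v w) - (\<theta> x w * (\<theta> x b * (v \<bullet> b)) - g x b w * (v \<bullet> b))
        + (g x v w * (\<theta> x b * (U x \<bullet> b)) - \<theta> x v * (g x b w * (U x \<bullet> b)))))"
    unfolding ricci_def ricci_of_def sum.distrib[symmetric] curvature_weyl[OF x]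
    by (intro sum.cong refl) (simp add: inner_left_distrib inner_diff_left algebra_simps)
  also have "\<dots> = ricci g x v w + (1/4) * (real DIM('e) * (\<theta> x v * \<theta> x w - g x v w)
      - (\<theta> x w * \<theta> x v - g x v w) + (g x v w * \<theta> x (U x) - \<theta> x v * g x (U x) w))"
    unfolding sum_distrib_left[symmetric] sum.distrib sum_subtractf 1 2 by (simp add: algebra_simps)
  also have "\<dots> = ricci g x v w + (real DIM('e) - 2) / 4 * (\<theta> x v * \<theta> x w - g x v w)"
  proof -
    have "(1/4) * (m * (a * b - c) - (b * a - c) + (c * 1 - a * b)) = (m - 2) / 4 * (a * b - c)"
      for m a b c :: real
      by (simp add: field_simps)
    then show ?thesis
      by (simp only: g_U[OF x] \<theta>_U[OF x])
  qed
  finally show ?thesis .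
qed

text \<open>This encodes \<open>D U = - id / 2\<close>; in \<open>weyl x u (U x)\<close> the two
  multiples of \<open>U\<close> cancel.\<close>

lemma dU_weyl:
  assumes x: "x \<in> S"
  shows "- \<Gamma> x u (U x) = - (1/2) *\<^sub>R u - weyl x u (U x)"
  by (simp add: weyl_def \<theta>_U[OF x] g_U'[OF x] algebra_simps)

text \<open>A parallel field is killed by all curvature operators, so
  \<open>curvature_on_field\<close> applies with \<open>E = 0\<close>.\<close>

lemma ricci_U: assumes x: "x \<in> S" shows "ricci g x v (U x) = 0"
proof -
  have "curvature \<Gamma> (\<lambda>_. u) (\<lambda>_. v) (\<lambda>_. U x) x = (0 + \<Gamma> x u 0) - (0 + \<Gamma> x v 0)" for u
    using dU by (intro curvature_on_field[OF S x \<Gamma>_C1, where E = "\<lambda>_ _. 0" and E' = "\<lambda>_ _. 0"]) auto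
  then show ?thesis
    by (simp add: ricci_def bilinear_rzero[OF \<Gamma>_bilinear[OF x]])
qed

lemma ricci_weyl_U: assumes x: "x \<in> S" shows "ricci_of weyl x v (U x) = 0"
  using ricci_weyl[OF x, of v "U x"] by (simp add: ricci_U[OF x] \<theta>_U[OF x] g_U'[OF x])

end

section \<open>Parallelism of \<open>J\<close> for the Weyl connection, and the Ricci tensor on
  \<open>J U\<close>\<close>

section \<open>Vaisman structures in coordinates\<close>

text \<open>Here \<open>P u v w\<close> stands for \<open>g(v, (D\<^sub>u J) w)\<close>. The hypothesis \<open>nij\<close> shows that
  \<open>P (J v) z w + P v (J z) w\<close> is symmetric in \<open>v\<close>, \<open>w\<close>; being skew in \<open>z\<close>, \<open>w\<close> it vanishes.\<close>

lemma hermitian_torsion_vanishes: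
  fixes P :: "'e \<Rightarrow> 'e \<Rightarrow> 'e \<Rightarrow> real"
  assumes skew: "\<And>u v w. P u v w = - P u w v"
    and J: "\<And>u v w. P u v (J w) = P u (J v) w"
    and cyc: "\<And>u v w. P u v w + P v w u + P w u v = 0"
    and nij: "\<And>z v w. P (J v) z w - P (J w) z v - P w (J z) v + P v (J z) w = 0"
  shows "P w (J u) v = 0"
proof -
  define Q where "Q v z w = P (J v) z w + P v (J z) w" for v z w
  have sym: "Q v z w = Q w z v" for v z w
    using nij[of v z w] by (simp add: Q_def)
  have sk: "Q v z w = - Q v w z" for v z w
    unfolding Q_def using skew[of "J v" z w] skew[of v z "J w"] J[of v z w] J[of v w z]
      skew[of v "J z" w] by linarith
  \<comment> \<open>Six alternating swaps, symmetric in the outer slots and skew in the last two,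
    return to the start with sign \<open>-1\<close>.\<close>
  have "Q v z w = 0" for v z w
    using sym[of v z w] sk[of w z v] sym[of w v z] sk[of z v w] sym[of z w v] sk[of v w z] by linarith
  then have Q: "P (J v) z w = - P v (J z) w" for v z w
    by (simp add: Q_def eq_neg_iff_add_eq_0)
  \<comment> \<open>In the sum of the cyclic identities at \<open>(J u, v, w)\<close> and
    \<open>(u, J v, w)\<close> everything cancels except twice the claim.\<close>
  show ?thesis
    using cyc[of "J u" v w] cyc[of u "J v" w] Q[of u v w] Q[of v w u] J[of v w u] J[of w u v]
    by linarith
qed

locale vaisman_chart = lee_chart S g \<theta>
  for S :: "'e::euclidean_space set" and g and \<theta> +
  fixes J :: "'e \<Rightarrow> 'e \<Rightarrow> 'e"
  assumes J_lin: "x \<in> S \<Longrightarrow> linear (J x)"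
    and J_diff: "x \<in> S \<Longrightarrow> (\<lambda>y. J y v) differentiable (at x)"
    and J_sq: "x \<in> S \<Longrightarrow> J x (J x v) = - v"
    and J_nijenhuis: "x \<in> S \<Longrightarrow> nijenhuis J x v w = 0"
    and J_isometry: "x \<in> S \<Longrightarrow> g x (J x v) (J x w) = g x v w"
    and lee_form: "x \<in> S \<Longrightarrow> ext_deriv_two_form (fundamental_form g J) x u v w =
      wedge_one_two \<theta> (fundamental_form g J) x u v w"
begin

abbreviation "dJ x w u \<equiv> dir_deriv (\<lambda>y. J y w) x u"

text \<open>The covariant derivative \<open>(D\<^sub>u J) w\<close> on constant fields
  \<open>u\<close>, \<open>w\<close>.\<close>

definition DJ :: "'e \<Rightarrow> 'e \<Rightarrow> 'e \<Rightarrow> 'e"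
  where "DJ x u w = dJ x w u + weyl x u (J x w) - J x (weyl x u w)"

lemmas J_simps = linear_add[OF J_lin] linear_diff[OF J_lin] linear_scale[OF J_lin] linear_neg[OF J_lin]

lemma has_derivative_J: "x \<in> S \<Longrightarrow> ((\<lambda>y. J y w) has_derivative dJ x w) (at x)"
  by (rule has_derivative_dir_deriv[OF J_diff])

lemma g_J: "x \<in> S \<Longrightarrow> g x v (J x w) = - g x (J x v) w"
  using J_isometry[of x "J x v" w] by (simp add: J_sq g_simps)

lemma g_J_skew: "x \<in> S \<Longrightarrow> g x v (J x w) = - g x w (J x v)"
  using g_J[of x v w] g_sym[of x w "J x v"] by simp

text \<open>Differentiate \<open>J (J w) = - w\<close>, whose right side is constant.\<close>

lemma dJ_J: assumes x: "x \<in> S" shows "dJ x (J x w) u + J x (dJ x w u) = 0"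
proof -
  have "((\<lambda>y. J y (J y w)) has_derivative (\<lambda>u. dJ x (J x w) u + J x (dJ x w u))) (at x)"
    by (intro has_derivative_linear_field[OF S x] J_lin has_derivative_J x)
  then have "((\<lambda>y. - w) has_derivative (\<lambda>u. dJ x (J x w) u + J x (dJ x w u))) (at x)"
    by (rule has_derivative_transform_within_open[OF _ S x]) (simp add: J_sq)
  from has_derivative_unique[OF this has_derivative_const] show ?thesis
    by meson
qed

lemma DJ_J: assumes x: "x \<in> S" shows "DJ x u (J x w) = - J x (DJ x u w)"
  using dJ_J[OF x, of w u]
  by (simp add: DJ_def J_sq[OF x] J_simps[OF x] bilinear_rneg[OF weyl_bilinear[OF x]] eq_neg_iff_add_eq_0)

lemma has_derivative_fundamental_form:
  assumes x: "x \<in> S"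
  shows "((\<lambda>y. fundamental_form g J y v w) has_derivative
    (\<lambda>u. g x (\<Gamma> x u v) (J x w) + g x v (\<Gamma> x u (J x w)) + g x v (dJ x w u))) (at x)"
  unfolding fundamental_form_def
  using g_bil by (intro has_derivative_linear_field[OF S x, where L = "\<lambda>y. g y v"]
      dg has_derivative_J x) (simp add: bilinear_linear2)

lemma fundamental_form_skew: "x \<in> S \<Longrightarrow> fundamental_form g J x v w = - fundamental_form g J x w v"
  unfolding fundamental_form_def by (rule g_J_skew)

lemma dir_deriv_fundamental_form_skew:
  assumes x: "x \<in> S"
  shows "dir_deriv (\<lambda>y. fundamental_form g J y v w) x u = - dir_deriv (\<lambda>y. fundamental_form g J y w v) x u"
proof (rule dir_deriv_eq)
  have "(\<lambda>y. fundamental_form g J y w v) differentiable (at x)"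
    using has_derivative_fundamental_form[OF x] unfolding differentiable_def by blast
  from has_derivative_minus[OF has_derivative_dir_deriv[OF this]]
  show "((\<lambda>y. fundamental_form g J y v w) has_derivative
      (\<lambda>u. - dir_deriv (\<lambda>y. fundamental_form g J y w v) x u)) (at x)"
    by (rule has_derivative_transform_within_open[OF _ S x]) (simp add: fundamental_form_skew[of _ v w])
qed

text \<open>\<open>D\<^sub>u\<omega> = \<theta>(u) \<omega> + g(\<cdot>, (D\<^sub>u J) \<cdot>)\<close>\<close>

lemma dir_deriv_fundamental_form_weyl:
  assumes x: "x \<in> S"
  shows "dir_deriv (\<lambda>y. fundamental_form g J y v w) x u =
    g x (weyl x u v) (J x w) - g x (weyl x u w) (J x v) + \<theta> x u * g x v (J x w) + g x v (DJ x u w)"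
  unfolding dir_deriv_eq[OF has_derivative_fundamental_form[OF x]] DJ_def g_J_skew[OF x, of "weyl x u w" v]
  by (simp add: weyl_def g_simps[OF x] J_simps[OF x] g_U[OF x] g_U'[OF x] g_sym[OF x, of u v]
      field_simps)

lemma nijenhuis_eq:
  "nijenhuis J x v w = dJ x w (J x v) - dJ x v (J x w) + J x (dJ x v w) - J x (dJ x w v)"
  if x: "x \<in> S"
  using linear_0[OF linear_dir_deriv[OF J_diff[OF x]]] linear_0[OF J_lin[OF x]]
  by (simp add: nijenhuis_def lie_bracket_def linear_neg[OF J_lin[OF x]] J_simps[OF x])

text \<open>As for Kaehler metrics, the conditions on \<open>d\<omega>\<close> and on the Nijenhuis
  tensor are rewritten with the torsion-free \<open>D\<close> and become algebraic identities for
  \<open>DJ\<close>; these force \<open>DJ\<close> to vanish.\<close>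

lemma DJ_zero:
  assumes x: "x \<in> S"
  shows "DJ x u w = 0"
proof -
  define P where "P u v w = g x v (DJ x u w)" for u v w
  have skew: "P u v w = - P u w v" for u v w
    using dir_deriv_fundamental_form_skew[OF x, of v w u]
    unfolding dir_deriv_fundamental_form_weyl[OF x] P_def
    by (simp add: g_J_skew[OF x, of w v])
  have J: "P u v (J x w) = P u (J x v) w" for u v w
    by (simp add: P_def DJ_J[OF x] g_simps[OF x] g_J[OF x])
  \<comment> \<open>In the cyclic sum of \<open>D\<omega>\<close> the Christoffel terms cancel,
    \<open>\<theta>(u) \<omega>\<close> sums to the wedge product, and \<open>lee_form\<close>
    leaves the cyclic sum of \<open>P\<close>.\<close>
  have cyc: "P u v w + P v w u + P w u v = 0" for u v w
  proof -
    have "ext_deriv_two_form (fundamental_form g J) x u v w =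
        wedge_one_two \<theta> (fundamental_form g J) x u v w + (P u v w + P v w u + P w u v)"
      unfolding ext_deriv_two_form_def wedge_one_two_def dir_deriv_fundamental_form_weyl[OF x]
      unfolding P_def fundamental_form_def
      by (simp add: weyl_sym[OF x, of v u] weyl_sym[OF x, of w u] weyl_sym[OF x, of w v])
    then show ?thesis
      using lee_form[OF x, of u v w] by simp
  qed
  \<comment> \<open>Because \<open>D\<close> is torsion free, the coordinate derivatives of
    \<open>J\<close> in the Nijenhuis tensor may be replaced by \<open>DJ\<close>; the identity is
    then paired with \<open>z\<close>.\<close>
  have nij: "P (J x v) z w - P (J x w) z v - P w (J x z) v + P v (J x z) w = 0" for z v w
  proof -
    have "nijenhuis J x v w = DJ x (J x v) w - DJ x (J x w) v + J x (DJ x w v) - J x (DJ x v w)"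
      unfolding nijenhuis_eq[OF x] DJ_def
      by (simp add: J_simps[OF x] J_sq[OF x] weyl_sym[OF x, of "J x v" "J x w"]
          weyl_sym[OF x, of w v] weyl_sym[OF x, of v "J x w"] weyl_sym[OF x, of w "J x v"] algebra_simps)
    then have "g x z (DJ x (J x v) w - DJ x (J x w) v + J x (DJ x w v) - J x (DJ x v w)) = 0"
      by (simp add: J_nijenhuis[OF x] bilinear_rzero[OF g_bil[OF x]])
    then show ?thesis
      by (simp add: P_def g_simps[OF x] g_J[OF x])
  qed
  have "g x (J x v) (DJ x u w) = 0" for v
    using hermitian_torsion_vanishes[of P "J x", OF skew J cyc nij, of u v w] by (simp add: P_def)
  \<comment> \<open>\<open>- J x v\<close> is the preimage of \<open>v\<close> under
    \<open>J x\<close>.\<close>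
  from this[of "- J x v" for v] have "g x v (DJ x u w) = 0" for v
    by (simp add: J_simps[OF x] J_sq[OF x])
  then have "g x (DJ x u w) v = 0" for v
    by (simp add: g_sym[OF x, of _ v])
  then show ?thesis
    by (intro g_eqI[OF x]) (simp add: bilinear_lzero[OF g_bil[OF x]])
qed

text \<open>From \<open>DJ = 0\<close> and \<open>D U = - id / 2\<close> follows
  \<open>D(J U) = - J / 2\<close>. This is again \<open>D\<close>-parallel, so its antisymmetrised
  derivative, the curvature on \<open>J U\<close>, is zero.\<close>

lemma ricci_weyl_JU: assumes x: "x \<in> S" shows "ricci_of weyl x v (J x (U x)) = 0"
proof -
  have d: "((\<lambda>z. J z (U z)) has_derivative
      (\<lambda>u. - (1/2) *\<^sub>R J y u - weyl y u (J y (U y)))) (at y)" if y: "y \<in> S" for y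
  proof -
    have "((\<lambda>z. J z (U z)) has_derivative (\<lambda>u. dJ y (U y) u + J y (- \<Gamma> y u (U y)))) (at y)"
      by (intro has_derivative_linear_field[OF S y] J_lin has_derivative_J dU y)
    moreover have "dJ y (U y) u + J y (- \<Gamma> y u (U y)) = - (1/2) *\<^sub>R J y u - weyl y u (J y (U y))" for u
      using DJ_zero[OF y, of u "U y"] unfolding dU_weyl[OF y] DJ_def
      by (simp add: J_simps[OF y] algebra_simps)
    ultimately show ?thesis
      by simp
  qed
  have E: "((\<lambda>y. - (1/2) *\<^sub>R J y a) has_derivative (\<lambda>u. - (1/2) *\<^sub>R dJ x a u)) (at x)" for a
    by (intro has_derivative_scaleR_right has_derivative_J x)
  \<comment> \<open>Both sides equal \<open>J\<close> applied to the symmetric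
    \<open>weyl x u a\<close>.\<close>
  have sym: "dJ x a u + weyl x u (J x a) = dJ x u a + weyl x a (J x u)" for a u
    using DJ_zero[OF x, of u a] DJ_zero[OF x, of a u] weyl_sym[OF x, of u a]
    unfolding DJ_def by (metis eq_iff_diff_eq_0)
  have "curvature weyl (\<lambda>_. u) (\<lambda>_. v) (\<lambda>_. J x (U x)) x =
      (- (1/2) *\<^sub>R dJ x v u + weyl x u (- (1/2) *\<^sub>R J x v))
      - (- (1/2) *\<^sub>R dJ x u v + weyl x v (- (1/2) *\<^sub>R J x u))" for u
    by (rule curvature_on_field[OF S x weyl_C1 d E])
  moreover have "- (1/2) *\<^sub>R dJ x a u + weyl x u (- (1/2) *\<^sub>R J x a)
      = - (1/2) *\<^sub>R (dJ x a u + weyl x u (J x a))" for a u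
    by (simp only: bilinear_rmul[OF weyl_bilinear[OF x]] scaleR_right_distrib)
  ultimately have "curvature weyl (\<lambda>_. u) (\<lambda>_. v) (\<lambda>_. J x (U x)) x = 0" for u
    using sym by simp
  then show ?thesis
    by (simp add: ricci_of_def)
qed

lemma g_JU: "x \<in> S \<Longrightarrow> g x (J x (U x)) (J x (U x)) = 1"
  by (simp add: J_isometry g_U \<theta>_U)

lemma \<theta>_JU: assumes x: "x \<in> S" shows "\<theta> x (J x (U x)) = 0"
  using g_J[OF x, of "U x" "U x"] g_U[OF x] g_U'[OF x] by simp

lemma ricci_JU: assumes x: "x \<in> S" shows "ricci g x (J x (U x)) (J x (U x)) = (real DIM('e) - 2) / 4"
  using ricci_weyl[OF x, of "J x (U x)" "J x (U x)"]
  by (simp add: ricci_weyl_JU[OF x] g_JU[OF x] \<theta>_JU[OF x])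

end

text \<open>For \<open>h = exp (- F) \<phi>^* g\<close> with \<open>dF = \<phi>^* \<theta>\<close>,
  the Koszul formula acquires \<open>\<theta>\<close> terms from the exponential, which turn
  \<open>\<Gamma>\<close> into \<open>weyl\<close>, and second derivatives of \<open>\<phi>\<close>,
  which give the inhomogeneous term. This is the law required by \<open>pullback_connection\<close>,
  whence the Ricci formula.\<close>

lemma (in lee_chart) conformal_pullback:
  fixes \<phi> :: "'e \<Rightarrow> 'e"
  assumes W: "open W" and \<phi>S: "\<And>y. y \<in> W \<Longrightarrow> \<phi> y \<in> S"
    and \<phi>1: "\<And>y. y \<in> W \<Longrightarrow> (\<phi> has_derivative \<phi>1 y) (at y)"
    and \<phi>2: "\<And>y v. y \<in> W \<Longrightarrow> ((\<lambda>z. \<phi>1 z v) has_derivative \<phi>2 y v) (at y)"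
    and inj: "\<And>y. y \<in> W \<Longrightarrow> inj (\<phi>1 y)"
    and F: "\<And>y. y \<in> W \<Longrightarrow> (F has_derivative (\<lambda>v. \<theta> (\<phi> y) (\<phi>1 y v))) (at y)"
    and h: "\<And>y v w. y \<in> W \<Longrightarrow> h y v w = exp (- F y) * g (\<phi> y) (\<phi>1 y v) (\<phi>1 y w)"
  shows christoffel_conformal_pullback: "y \<in> W \<Longrightarrow>
      \<phi>1 y (christoffel h y v w) = weyl (\<phi> y) (\<phi>1 y v) (\<phi>1 y w) + \<phi>2 y w v"
    and ricci_conformal_pullback:
      "\<lbrakk>\<And>y v w. y \<in> W \<Longrightarrow> (\<lambda>z. \<phi>2 z w v) differentiable (at y); x \<in> W\<rbrakk> \<Longrightarrow>
      ricci h x v w = ricci_of weyl (\<phi> x) (\<phi>1 x v) (\<phi>1 x w)"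
proof -
  show Gam: "\<phi>1 y (christoffel h y v w) = weyl (\<phi> y) (\<phi>1 y v) (\<phi>1 y w) + \<phi>2 y w v"
    if y: "y \<in> W" for y v w
  proof -
    note p = \<phi>S[OF y]
    have lin1: "linear (\<phi>1 y)"
      using \<phi>1[OF y] has_derivative_linear by blast
    obtain P where P: "\<And>a. \<phi>1 y (P a) = a"
      using linear_injective_isomorphism[OF lin1 inj[OF y]] by blast
    have sym2: "\<phi>2 y v w = \<phi>2 y w v" for v w
      by (rule symmetric_second_derivative[OF W y \<phi>1 \<phi>2[OF y] \<phi>2[OF y]])
    have bil: "bilinear (h y)"
      unfolding bilinear_def
      by (intro conjI allI linearI)
        (simp_all add: h[OF y] linear_add[OF lin1] linear_scale[OF lin1] g_simps[OF p] algebra_simps)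
    have pos: "h y v v > 0" if "v \<noteq> 0" for v
    proof -
      have "\<phi>1 y v \<noteq> 0"
        using that inj[OF y] linear_0[OF lin1] by (metis injD)
      then show ?thesis
        by (simp add: h[OF y] g_pos[OF p])
    qed
    have dh: "dir_deriv (\<lambda>z. h z v w) y u = exp (- F y) *
      (g (\<phi> y) (\<Gamma> (\<phi> y) (\<phi>1 y u) (\<phi>1 y v)) (\<phi>1 y w) + g (\<phi> y) (\<phi>1 y v) (\<Gamma> (\<phi> y) (\<phi>1 y u) (\<phi>1 y w))
        + g (\<phi> y) (\<phi>2 y v u) (\<phi>1 y w) + g (\<phi> y) (\<phi>1 y v) (\<phi>2 y w u)
        - \<theta> (\<phi> y) (\<phi>1 y u) * g (\<phi> y) (\<phi>1 y v) (\<phi>1 y w))" for u v w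
    proof -
      have "((\<lambda>z. g (\<phi> z) (\<phi>1 z v) (\<phi>1 z w)) has_derivative
        (\<lambda>u. (g (\<phi> y) (\<Gamma> (\<phi> y) (\<phi>1 y u) (\<phi>1 y v)) (\<phi>1 y w)
          + g (\<phi> y) (\<phi>1 y v) (\<Gamma> (\<phi> y) (\<phi>1 y u) (\<phi>1 y w)))
        + g (\<phi> y) (\<phi>2 y v u) (\<phi>1 y w) + g (\<phi> y) (\<phi>1 y v) (\<phi>2 y w u))) (at y)"
        by (intro has_derivative_bilinear_field[OF W y, where L = "\<lambda>z. g (\<phi> z)"] g_bil \<phi>S \<phi>2 y
            has_derivative_compose[OF \<phi>1[OF y] dg[OF p]])
      moreover have "((\<lambda>z. exp (- F z)) has_derivative
          (\<lambda>u. exp (- F y) * - \<theta> (\<phi> y) (\<phi>1 y u))) (at y)"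
        using F[OF y] by (auto intro!: derivative_eq_intros)
      ultimately have "((\<lambda>z. exp (- F z) * g (\<phi> z) (\<phi>1 z v) (\<phi>1 z w)) has_derivative
        (\<lambda>u. exp (- F y) * ((g (\<phi> y) (\<Gamma> (\<phi> y) (\<phi>1 y u) (\<phi>1 y v)) (\<phi>1 y w)
          + g (\<phi> y) (\<phi>1 y v) (\<Gamma> (\<phi> y) (\<phi>1 y u) (\<phi>1 y w)))
        + g (\<phi> y) (\<phi>2 y v u) (\<phi>1 y w) + g (\<phi> y) (\<phi>1 y v) (\<phi>2 y w u))
        + exp (- F y) * - \<theta> (\<phi> y) (\<phi>1 y u) * g (\<phi> y) (\<phi>1 y v) (\<phi>1 y w))) (at y)"
        by (rule has_derivative_mult[rotated])
      then have "((\<lambda>z. h z v w) has_derivative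
        (\<lambda>u. exp (- F y) * ((g (\<phi> y) (\<Gamma> (\<phi> y) (\<phi>1 y u) (\<phi>1 y v)) (\<phi>1 y w)
          + g (\<phi> y) (\<phi>1 y v) (\<Gamma> (\<phi> y) (\<phi>1 y u) (\<phi>1 y w)))
        + g (\<phi> y) (\<phi>2 y v u) (\<phi>1 y w) + g (\<phi> y) (\<phi>1 y v) (\<phi>2 y w u))
        + exp (- F y) * - \<theta> (\<phi> y) (\<phi>1 y u) * g (\<phi> y) (\<phi>1 y v) (\<phi>1 y w))) (at y)"
        by (rule has_derivative_transform_within_open[OF _ W y]) (simp add: h)
      from dir_deriv_eq[OF this, of u] show ?thesis
        by (simp add: algebra_simps)
    qed
    have "christoffel h y v w = P (weyl (\<phi> y) (\<phi>1 y v) (\<phi>1 y w) + \<phi>2 y w v)"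
    proof (rule christoffel_eqI[where g = h, OF bil pos])
      fix u
      let ?g = "g (\<phi> y)" and ?G = "\<Gamma> (\<phi> y)" and ?v = "\<phi>1 y v" and ?w = "\<phi>1 y w" and ?u = "\<phi>1 y u"
      have "2 * ?g (weyl (\<phi> y) ?v ?w) ?u = 2 * ?g (?G ?v ?w) ?u
          - \<theta> (\<phi> y) ?v * ?g ?w ?u - \<theta> (\<phi> y) ?w * ?g ?v ?u + ?g ?v ?w * \<theta> (\<phi> y) ?u"
        by (simp add: weyl_def g_simps[OF p] g_U[OF p] algebra_simps)
      \<comment> \<open>The three brackets are the Koszul derivatives of \<open>h\<close> without
        the factor \<open>exp (- F y)\<close>; the second derivatives of \<open>\<phi>\<close>
        cancel in pairs except for twice \<open>\<phi>2 y w v\<close>.\<close>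
      then have "2 * ?g (weyl (\<phi> y) ?v ?w + \<phi>2 y w v) ?u =
          (?g (?G ?v ?w) ?u + ?g ?w (?G ?v ?u) + ?g (\<phi>2 y w v) ?u + ?g ?w (\<phi>2 y u v) - \<theta> (\<phi> y) ?v * ?g ?w ?u)
        + (?g (?G ?w ?v) ?u + ?g ?v (?G ?w ?u) + ?g (\<phi>2 y v w) ?u + ?g ?v (\<phi>2 y u w) - \<theta> (\<phi> y) ?w * ?g ?v ?u)
        - (?g (?G ?u ?v) ?w + ?g ?v (?G ?u ?w) + ?g (\<phi>2 y v u) ?w + ?g ?v (\<phi>2 y w u) - \<theta> (\<phi> y) ?u * ?g ?v ?w)"
        by (simp add: g_simps[OF p] \<Gamma>_sym[OF p, of ?w ?v] \<Gamma>_sym[OF p, of ?u ?v] \<Gamma>_sym[OF p, of ?u ?w]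
            sym2[of v w] sym2[of u v] sym2[of u w] g_sym[OF p, of ?w])
      from arg_cong[where f = "\<lambda>t. exp (- F y) * t", OF this]
      show "2 * h y (P (weyl (\<phi> y) ?v ?w + \<phi>2 y w v)) u =
          dir_deriv (\<lambda>z. h z w u) y v + dir_deriv (\<lambda>z. h z v u) y w - dir_deriv (\<lambda>z. h z v w) y u"
        unfolding dh h[OF y] P by (simp only: right_diff_distrib distrib_left mult.left_commute[of 2])
    qed
    then show ?thesis
      by (simp add: P)
  qed
  show "ricci h x v w = ricci_of weyl (\<phi> x) (\<phi>1 x v) (\<phi>1 x w)"
    if "\<And>y v w. y \<in> W \<Longrightarrow> (\<lambda>z. \<phi>2 z w v) differentiable (at y)" "x \<in> W" for x v w
    unfolding ricci_eq_ricci_of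
    by (rule ricci_of_pullback[where \<Gamma> = "christoffel h" and ?\<phi>1.0 = \<phi>1 and ?\<phi>2.0 = \<phi>2,
          OF S W \<phi>S weyl_C1 \<phi>1 \<phi>2 that(1) inj Gam that(2)])
qed

section \<open>Passage from the manifold and its cover to local coordinate data\<close>

section \<open>Charts and local diffeomorphisms\<close>

lemma smooth_on_differentiable: "smooth_on S F \<Longrightarrow> x \<in> S \<Longrightarrow> F differentiable (at x)"
  unfolding smooth_on_def using Ck_on.simps(2) by blast

lemma smooth_on_dir_deriv: "smooth_on S F \<Longrightarrow> smooth_on S (\<lambda>x. dir_deriv F x v)"
  unfolding smooth_on_def using Ck_on.simps(2) by blast

lemma smooth_on_const: "smooth_on S (\<lambda>_. a)"
proof -
  have "Ck_on k S (\<lambda>_. a)" for k and a :: 'b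
    by (induction k arbitrary: a) simp_all
  then show ?thesis
    by (simp add: smooth_on_def)
qed

lemma smooth_fun_const: "smooth_fun A (\<lambda>_. a)"
  by (simp add: smooth_fun_def o_def smooth_on_const)

context smooth_manifold
begin

lemma cinv_cmap: "c \<in> A \<Longrightarrow> p \<in> cdom c \<Longrightarrow> cinv c (cmap c p) = p"
  using chart_homeo homeomorphism_apply1 by fastforce

lemma cinv_in: "c \<in> A \<Longrightarrow> x \<in> cimg c \<Longrightarrow> cinv c x \<in> cdom c"
  unfolding cimg_def cinv_def by (rule inv_into_into)

lemma cmap_cinv: "x \<in> cimg c \<Longrightarrow> cmap c (cinv c x) = x"
  unfolding cimg_def cinv_def by (rule f_inv_into_f)

lemma cmap_in: "p \<in> cdom c \<Longrightarrow> cmap c p \<in> cimg c"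
  by (simp add: cimg_def)

lemma chart_at:
  assumes "c \<in> A" "p \<in> cdom c"
  shows "chart_at A p \<in> A" "p \<in> cdom (chart_at A p)"
  using someI[of "\<lambda>c. c \<in> A \<and> p \<in> cdom c" c] assms by (auto simp: chart_at_def)

lemma open_cmap_image:
  assumes c: "c \<in> A" and V: "openin (top_of_set M) V"
  shows "open (cmap c ` (V \<inter> cdom c))"
proof -
  have "openin (top_of_set M) (V \<inter> cdom c)"
    using V chart_dom[OF c] by (rule openin_Int)
  then have "openin (top_of_set (cdom c)) (V \<inter> cdom c)"
    using chart_dom[OF c] by (auto intro: openin_subset_trans dest: openin_imp_subset)
  then have "openin (top_of_set (cimg c)) (cmap c ` (V \<inter> cdom c))"
    by (rule homeomorphism_imp_open_map[OF chart_homeo[OF c]])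
  then show ?thesis
    using chart_img[OF c] openin_open_eq by blast
qed

end

text \<open>Pullbacks are defined through the unspecified \<open>chart_at\<close>; near
  \<open>q\<close> they are computed here in the prescribed chart \<open>d\<close>, by the chain
  rule and the tensor transformation rules.\<close>

lemma local_diffeomorphism_chart:
  fixes A :: "('a::topological_space, 'e::euclidean_space) chart set"
    and B :: "('b::topological_space, 'e) chart set"
  assumes N: "smooth_manifold N B" and M: "smooth_manifold M A"
    and F: "local_diffeomorphism N B M A F"
    and c: "c \<in> B" and d: "d \<in> A" and q: "q \<in> cdom c" "F q \<in> cdom d"
  obtains W where "open W" "cmap c q \<in> W" "W \<subseteq> cimg c"
    "smooth_on W (coord_rep c F d)"
    "\<And>y. y \<in> W \<Longrightarrow> coord_rep c F d y \<in> cimg d"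
    "\<And>y. y \<in> W \<Longrightarrow> inj (dir_deriv (coord_rep c F d) y)"
    "\<And>\<theta> y v. one_form_on A \<theta> \<Longrightarrow> y \<in> W \<Longrightarrow>
      pullback_one_form A F \<theta> c y v = \<theta> d (coord_rep c F d y) (dir_deriv (coord_rep c F d) y v)"
    "\<And>g y v w. bilinear_field_on A g \<Longrightarrow> y \<in> W \<Longrightarrow> pullback_bilinear A F g c y v w =
      g d (coord_rep c F d y) (dir_deriv (coord_rep c F d) y v) (dir_deriv (coord_rep c F d) y w)"
proof -
  interpret N: smooth_manifold N B by (rule N)
  interpret M: smooth_manifold M A by (rule M)
  have "q \<in> N"
    using N.covering c q by blast
  then obtain V where V: "q \<in> V" "openin (top_of_set N) V" "openin (top_of_set M) (F ` V)" "inj_on F V"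
    "smooth_map_on B A V F" "smooth_map_on A B (F ` V) (inv_into V F)"
    using F unfolding local_diffeomorphism_def by blast
  define W where "W = cmap c ` (V \<inter> cdom c \<inter> F -` cdom d)"
  define \<phi> where "\<phi> = coord_rep c F d"
  have preim: "openin (top_of_set N) (V \<inter> F -` cdom d')" if "d' \<in> A" for d'
  proof -
    have "openin (top_of_set V) (V \<inter> F -` cdom d')"
      using V(3,5) M.chart_dom[OF that]
      by (intro continuous_openin_preimage[where T = M]) (auto simp: smooth_map_on_def dest: openin_imp_subset)
    then show ?thesis
      using V(2) by (rule openin_trans)
  qed
  have "W = cmap c ` ((V \<inter> F -` cdom d) \<inter> cdom c)"
    by (auto simp: W_def)
  then have oW: "open W"
    using N.open_cmap_image[OF c preim[OF d]] by simp
  have qW: "cmap c q \<in> W"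
    using V(1) q by (auto simp: W_def)
  have Wsub: "W \<subseteq> cimg c"
    by (auto simp: W_def cimg_def)
  have cinvW: "cinv c y \<in> V" "cinv c y \<in> cdom c" "F (cinv c y) \<in> cdom d" "cmap c (cinv c y) = y"
    if "y \<in> W" for y
    using that N.cinv_cmap[OF c] by (auto simp: W_def)
  have sm: "smooth_on W \<phi>"
    using V(5) c d by (auto simp: smooth_map_on_def W_def \<phi>_def)
  have \<phi>: "\<phi> y = cmap d (F (cinv c y))" for y
    by (simp add: \<phi>_def coord_rep_def)
  have cinv\<phi>: "cinv d (\<phi> y) = F (cinv c y)" if "y \<in> W" for y
    by (simp add: \<phi> M.cinv_cmap[OF d] cinvW[OF that])
  have im: "\<phi> y \<in> cimg d" if "y \<in> W" for y
    by (simp add: \<phi> M.cmap_in cinvW[OF that])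
  have d\<phi>: "(\<phi> has_derivative dir_deriv \<phi> y) (at y)" if "y \<in> W" for y
    by (rule has_derivative_dir_deriv[OF smooth_on_differentiable[OF sm that]])
  \<comment> \<open>The coordinate form of the local inverse is a left inverse of
    \<open>\<phi>\<close>; the chain rule transfers this to the differentials.\<close>
  have inj: "inj (dir_deriv \<phi> y)" if y: "y \<in> W" for y
  proof -
    define \<psi> where "\<psi> = coord_rep d (inv_into V F) c"
    have inv: "inv_into V F (F (cinv c z)) = cinv c z" if "z \<in> W" for z
      by (rule inv_into_f_f[OF V(4) cinvW(1)[OF that]])
    have "smooth_on (cmap d ` (F ` V \<inter> cdom d \<inter> inv_into V F -` cdom c)) \<psi>"
      using V(6) c d by (auto simp: smooth_map_on_def \<psi>_def)
    moreover have "\<phi> y \<in> cmap d ` (F ` V \<inter> cdom d \<inter> inv_into V F -` cdom c)"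
      unfolding \<phi> using cinvW[OF y] inv[OF y] by (intro imageI) auto
    ultimately have d\<psi>: "(\<psi> has_derivative dir_deriv \<psi> (\<phi> y)) (at (\<phi> y))"
      using has_derivative_dir_deriv smooth_on_differentiable by blast
    have \<psi>\<phi>: "\<psi> (\<phi> z) = z" if "z \<in> W" for z
      by (simp add: \<psi>_def coord_rep_def cinv\<phi>[OF that] inv[OF that] cinvW[OF that])
    have "((\<lambda>z. z) has_derivative (\<lambda>v. dir_deriv \<psi> (\<phi> y) (dir_deriv \<phi> y v))) (at y)"
      by (rule has_derivative_transform_within_open[OF has_derivative_compose[OF d\<phi>[OF y] d\<psi>] oW y])
        (rule \<psi>\<phi>)
    from has_derivative_unique[OF this has_derivative_ident]
    have "dir_deriv \<psi> (\<phi> y) (dir_deriv \<phi> y v) = v" for v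
      by meson
    then show ?thesis
      by (metis injI)
  qed
  have chain: "dir_deriv (coord_rep c F d') y v =
      dir_deriv (coord_rep d id d') (cmap d (F (cinv c y))) (dir_deriv \<phi> y v)"
    if y: "y \<in> W" and d': "d' \<in> A" "F (cinv c y) \<in> cdom d'" for y d' v
  proof (rule dir_deriv_eq)
    \<comment> \<open>A smaller neighbourhood on which \<open>F\<close> also lands in
      \<open>d'\<close>, so that passing through the transition map from \<open>d\<close> to
      \<open>d'\<close> makes sense.\<close>
    let ?W = "cmap c ` ((V \<inter> F -` cdom d) \<inter> (V \<inter> F -` cdom d') \<inter> cdom c)"
    have o: "open ?W"
      by (rule N.open_cmap_image[OF c openin_Int[OF preim[OF d] preim[OF d'(1)]]])
    have yW: "y \<in> ?W"
      by (rule image_eqI[of _ _ "cinv c y"]) (use cinvW[OF y] d' in auto)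
    have "\<phi> y \<in> cmap d ` (cdom d \<inter> cdom d')"
      unfolding \<phi> using cinvW[OF y] d' by (intro imageI) auto
    then have "(coord_rep d id d' has_derivative dir_deriv (coord_rep d id d') (\<phi> y)) (at (\<phi> y))"
      using M.compatible[OF d d'(1)] has_derivative_dir_deriv smooth_on_differentiable by blast
    from has_derivative_compose[OF d\<phi>[OF y] this]
    show "(coord_rep c F d' has_derivative
        (\<lambda>v. dir_deriv (coord_rep d id d') (cmap d (F (cinv c y))) (dir_deriv \<phi> y v))) (at y)"
      unfolding \<phi>[symmetric]
    proof (rule has_derivative_transform_within_open[OF _ o yW])
      fix z assume "z \<in> ?W"
      then have "z \<in> W"
        by (auto simp: W_def)
      then show "coord_rep d id d' (\<phi> z) = coord_rep c F d' z"
        by (simp add: coord_rep_def[of d id] cinv\<phi>) (simp add: coord_rep_def)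
    qed
  qed
  note ch = M.chart_at[OF d cinvW(3)]
  have pb1: "pullback_one_form A F \<theta> c y v = \<theta> d (\<phi> y) (dir_deriv \<phi> y v)"
    if \<theta>: "one_form_on A \<theta>" and y: "y \<in> W" for \<theta> y v
  proof -
    have "\<theta> d (\<phi> y) a = \<theta> (chart_at A (F (cinv c y))) (cmap (chart_at A (F (cinv c y))) (F (cinv c y)))
        (dir_deriv (coord_rep d id (chart_at A (F (cinv c y)))) (\<phi> y) a)" for a
      unfolding \<phi> by (rule \<theta>[unfolded one_form_on_def, THEN conjunct2, rule_format, OF d ch(1)[OF y] IntI[OF cinvW(3)[OF y] ch(2)[OF y]]])
    then show ?thesis
      by (simp only: pullback_one_form_def Let_def chain[OF y ch[OF y]] flip: \<phi>)
  qed
  have pb2: "pullback_bilinear A F g c y v w = g d (\<phi> y) (dir_deriv \<phi> y v) (dir_deriv \<phi> y w)"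
    if g: "bilinear_field_on A g" and y: "y \<in> W" for g y v w
  proof -
    have "g d (\<phi> y) a b = g (chart_at A (F (cinv c y))) (cmap (chart_at A (F (cinv c y))) (F (cinv c y)))
        (dir_deriv (coord_rep d id (chart_at A (F (cinv c y)))) (\<phi> y) a)
        (dir_deriv (coord_rep d id (chart_at A (F (cinv c y)))) (\<phi> y) b)" for a b
      unfolding \<phi> by (rule g[unfolded bilinear_field_on_def, THEN conjunct2, rule_format, OF d ch(1)[OF y] IntI[OF cinvW(3)[OF y] ch(2)[OF y]]])
    then show ?thesis
      by (simp only: pullback_bilinear_def Let_def chain[OF y ch[OF y]] flip: \<phi>)
  qed
  show thesis
    using that[OF oW qW Wsub] sm im inj pb1 pb2 unfolding \<phi>_def by blast
qed

lemma vaisman_manifold_chart: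
  assumes M: "vaisman_manifold M A g J \<theta>"
    and norm: "\<forall>c\<in>A. \<forall>x\<in>cimg c. one_form_norm (g c) (\<theta> c) x = 1"
    and c: "c \<in> A"
  shows "vaisman_chart (cimg c) (g c) (\<theta> c) (J c)"
proof -
  interpret vaisman_manifold M A g J \<theta> by (rule M)
  have g: "\<forall>x\<in>cimg c. bilinear (g c x)" "smooth_on (cimg c) (\<lambda>x. g c x v w)" for v w
    using metric_tensor c unfolding bilinear_field_on_def by blast+
  have \<theta>: "\<forall>x\<in>cimg c. linear (\<theta> c x)" "smooth_on (cimg c) (\<lambda>x. \<theta> c x v)" for v
    using lee_tensor c unfolding one_form_on_def by blast+
  have J: "\<forall>x\<in>cimg c. linear (J c x)" "smooth_on (cimg c) (\<lambda>x. J c x v)" for v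
    using J_tensor c unfolding endomorphism_field_on_def by blast+
  have "metric_chart (cimg c) (g c)"
    by (rule metric_chart.intro)
      (fact chart_img[OF c] metric_sym[OF c] metric_pos[OF c] bspec[OF g(1)]
        smooth_on_differentiable[OF g(2)] smooth_on_differentiable[OF smooth_on_dir_deriv[OF g(2)]])+
  moreover have "lee_chart_axioms (cimg c) (g c) (\<theta> c)"
    by (rule lee_chart_axioms.intro)
      (fact bspec[OF \<theta>(1)] smooth_on_differentiable[OF \<theta>(2)] lee_parallel[OF c] bspec[OF bspec[OF norm c]])+
  moreover have "vaisman_chart_axioms (cimg c) (g c) (\<theta> c) (J c)"
    by (rule vaisman_chart_axioms.intro)
      (fact bspec[OF J(1)] smooth_on_differentiable[OF J(2)] J_square[OF c] J_integrable[OF c]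
        J_metric[OF c] lee_form[OF c])+
  ultimately show ?thesis
    by (intro vaisman_chart.intro lee_chart.intro)
qed

text \<open>\<open>L\<close> is the differential of \<open>\<pi>\<close> at \<open>q\<close> in the
  charts \<open>c\<close> and \<open>d\<close>. It carries the metric of the cover and its Ricci
  tensor to conformal and Weyl data at \<open>\<pi> q\<close>.\<close>

lemma kaehler_cover_metric_chart:
  fixes A :: "('a::topological_space, 'e::euclidean_space) chart set"
    and B :: "('b::topological_space, 'e) chart set"
  assumes M: "vaisman_manifold M A g J \<theta>"
    and norm: "\<forall>c\<in>A. \<forall>x\<in>cimg c. one_form_norm (g c) (\<theta> c) x = 1"
    and cover: "universal_cover N B M A \<pi>"
    and f: "lee_potential B A \<pi> \<theta> f"
    and c: "c \<in> B" and d: "d \<in> A" and q: "q \<in> cdom c" "\<pi> q \<in> cdom d"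
  obtains L where "bij L"
    "\<And>v w. ricci (kaehler_cover_metric A \<pi> f g c) (cmap c q) v w =
      ricci_of (lee_chart.weyl (g d) (\<theta> d)) (cmap d (\<pi> q)) (L v) (L w)"
    "\<And>v w. kaehler_cover_metric A \<pi> f g c (cmap c q) v w =
      exp (- f q) * g d (cmap d (\<pi> q)) (L v) (L w)"
proof -
  interpret M: vaisman_manifold M A g J \<theta> by (rule M)
  interpret N: smooth_manifold N B
    using cover by (simp add: universal_cover_def)
  have loc: "local_diffeomorphism N B M A \<pi>"
    using cover by (simp add: universal_cover_def)
  interpret C: vaisman_chart "cimg d" "g d" "\<theta> d" "J d"
    by (rule vaisman_manifold_chart[OF M norm d])
  let ?\<phi> = "coord_rep c \<pi> d"
  obtain W where W: "open W" "cmap c q \<in> W" "W \<subseteq> cimg c"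
    and sm: "smooth_on W ?\<phi>"
    and im: "\<And>y. y \<in> W \<Longrightarrow> ?\<phi> y \<in> cimg d"
    and inj: "\<And>y. y \<in> W \<Longrightarrow> inj (dir_deriv ?\<phi> y)"
    and pb1: "\<And>\<theta> y v. one_form_on A \<theta> \<Longrightarrow> y \<in> W \<Longrightarrow>
      pullback_one_form A \<pi> \<theta> c y v = \<theta> d (?\<phi> y) (dir_deriv ?\<phi> y v)"
    and pb2: "\<And>g y v w. bilinear_field_on A g \<Longrightarrow> y \<in> W \<Longrightarrow>
      pullback_bilinear A \<pi> g c y v w = g d (?\<phi> y) (dir_deriv ?\<phi> y v) (dir_deriv ?\<phi> y w)"
    by (rule local_diffeomorphism_chart[OF N.smooth_manifold_axioms M.smooth_manifold_axioms loc c d q]) (rule that, assumption+)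
  have d1: "(?\<phi> has_derivative dir_deriv ?\<phi> y) (at y)" if "y \<in> W" for y
    by (rule has_derivative_dir_deriv[OF smooth_on_differentiable[OF sm that]])
  have d2: "((\<lambda>z. dir_deriv ?\<phi> z v) has_derivative dir_deriv (\<lambda>z. dir_deriv ?\<phi> z v) y) (at y)"
    if "y \<in> W" for y v
    by (rule has_derivative_dir_deriv[OF smooth_on_differentiable[OF smooth_on_dir_deriv[OF sm] that]])
  have d3: "(\<lambda>z. dir_deriv (\<lambda>z. dir_deriv ?\<phi> z w) z v) differentiable (at y)" if "y \<in> W" for y v w
    by (rule smooth_on_differentiable[OF smooth_on_dir_deriv[OF smooth_on_dir_deriv[OF sm]] that])
  have df: "((f \<circ> cinv c) has_derivative (\<lambda>v. \<theta> d (?\<phi> y) (dir_deriv ?\<phi> y v))) (at y)" if y: "y \<in> W" for y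
  proof (rule has_derivative_eq_rhs)
    have "smooth_on (cimg c) (f \<circ> cinv c)"
      using f c unfolding lee_potential_def smooth_fun_def by blast
    then show "((f \<circ> cinv c) has_derivative dir_deriv (f \<circ> cinv c) y) (at y)"
      using y W(3) has_derivative_dir_deriv smooth_on_differentiable by blast
    show "dir_deriv (f \<circ> cinv c) y = (\<lambda>v. \<theta> d (?\<phi> y) (dir_deriv ?\<phi> y v))"
      using f c y W(3) pb1[OF M.lee_tensor y] unfolding lee_potential_def by (auto simp: fun_eq_iff)
  qed
  have h: "kaehler_cover_metric A \<pi> f g c y v w =
      exp (- (f \<circ> cinv c) y) * g d (?\<phi> y) (dir_deriv ?\<phi> y v) (dir_deriv ?\<phi> y w)" if "y \<in> W" for y v w
    by (simp add: kaehler_cover_metric_def pb2[OF M.metric_tensor that])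
  have ric: "ricci (kaehler_cover_metric A \<pi> f g c) (cmap c q) v w =
      ricci_of C.weyl (?\<phi> (cmap c q)) (dir_deriv ?\<phi> (cmap c q) v) (dir_deriv ?\<phi> (cmap c q) w)" for v w
    by (rule C.ricci_conformal_pullback[OF W(1) im d1 d2 inj df h d3 W(2)])
  have \<phi>q: "?\<phi> (cmap c q) = cmap d (\<pi> q)"
    by (simp add: coord_rep_def N.cinv_cmap[OF c q(1)])
  have "surj (dir_deriv ?\<phi> (cmap c q))"
    using linear_injective_imp_surjective[OF has_derivative_linear[OF d1] inj] W(2) by simp
  then have "bij (dir_deriv ?\<phi> (cmap c q))"
    using inj[OF W(2)] by (simp add: bij_def)
  then show thesis
    using that ric h[OF W(2)] by (simp add: \<phi>q N.cinv_cmap[OF c q(1)])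
qed

section \<open>From the identities in charts to the equivalence on \<open>M\<close> and its
  cover\<close>

theorem claim4p5:
  fixes n :: nat
    and M :: "'a::topological_space set"
    and A :: "('a, 'e::euclidean_space) chart set"
    and g :: "('a, 'e) chart \<Rightarrow> 'e \<Rightarrow> 'e \<Rightarrow> 'e \<Rightarrow> real"
    and J :: "('a, 'e) chart \<Rightarrow> 'e \<Rightarrow> 'e \<Rightarrow> 'e"
    and \<theta> :: "('a, 'e) chart \<Rightarrow> 'e \<Rightarrow> 'e \<Rightarrow> real"
    and N :: "'b::topological_space set"
    and B :: "('b, 'e) chart set"
    and \<pi> :: "'b \<Rightarrow> 'a"
    and f :: "'b \<Rightarrow> real"
  assumes "n \<ge> 1" and "DIM('e) = 2 * n + 2"
    and "compact M" and "connected M"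
    and "vaisman_manifold M A g J \<theta>"
    and "\<And>c x. c \<in> A \<Longrightarrow> x \<in> cimg c \<Longrightarrow> one_form_norm (g c) (\<theta> c) x = 1"
    and "universal_cover N B M A \<pi>"
    and "lee_potential B A \<pi> \<theta> f"
  shows "einstein_weyl B A \<pi> f g \<longleftrightarrow> quasi_einstein A g \<theta>"
proof -
  interpret M: vaisman_manifold M A g J \<theta> by (rule assms(5))
  interpret N: smooth_manifold N B
    using assms(7) by (simp add: universal_cover_def)
  have surj: "\<pi> ` N = M"
    using assms(7) covering_space_imp_surjective unfolding universal_cover_def by blast
  have norm: "\<forall>c\<in>A. \<forall>x\<in>cimg c. one_form_norm (g c) (\<theta> c) x = 1"
    using assms(6) by blast
  note chart = vaisman_manifold_chart[OF assms(5) norm]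
  note cover = kaehler_cover_metric_chart[OF assms(5) norm assms(7,8)]
  show ?thesis
  proof
    assume "einstein_weyl B A \<pi> f g"
    then obtain k where k: "\<And>c x v w. c \<in> B \<Longrightarrow> x \<in> cimg c \<Longrightarrow>
        ricci (kaehler_cover_metric A \<pi> f g c) x v w = k * kaehler_cover_metric A \<pi> f g c x v w"
      unfolding einstein_weyl_def einstein_metric_def by blast
    \<comment> \<open>The constant \<open>n / 2\<close> is \<open>(m - 2) / 4\<close> for
      \<open>m = 2 n + 2\<close>, the factor in \<open>ricci_weyl\<close>.\<close>
    have "ricci (g d) (cmap d p) v w =
        n / 2 * g d (cmap d p) v w + - (n / 2) * (\<theta> d (cmap d p) v * \<theta> d (cmap d p) w)"
      if d: "d \<in> A" and p: "p \<in> cdom d" for d p v w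
    proof -
      interpret C: vaisman_chart "cimg d" "g d" "\<theta> d" "J d"
        by (rule chart[OF d])
      have x: "cmap d p \<in> cimg d"
        using p by (rule M.cmap_in)
      obtain q c where q: "\<pi> q = p" "c \<in> B" "q \<in> cdom c"
      proof -
        have "p \<in> \<pi> ` N"
          using surj M.covering d p by blast
        then obtain q where "\<pi> q = p" "q \<in> N"
          by blast
        then show thesis
          using that N.covering by blast
      qed
      obtain L where L: "bij L"
        "\<And>v w. ricci (kaehler_cover_metric A \<pi> f g c) (cmap c q) v w =
          ricci_of C.weyl (cmap d p) (L v) (L w)"
        "\<And>v w. kaehler_cover_metric A \<pi> f g c (cmap c q) v w = exp (- f q) * g d (cmap d p) (L v) (L w)"
        using cover[OF q(2) d q(3)] p unfolding q(1) by blast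
      \<comment> \<open>Vectors at \<open>p\<close> are lifted by \<open>inv L\<close>, so the
        Einstein equation at \<open>q\<close> covers all \<open>v\<close>, \<open>w\<close>.\<close>
      have ric: "ricci_of C.weyl (cmap d p) v w = k * (exp (- f q) * g d (cmap d p) v w)" for v w
        using k[OF q(2) N.cmap_in[OF q(3)], of "inv L v" "inv L w"] L by (simp add: bij_is_surj surj_f_inv_f)
      \<comment> \<open>At \<open>(U, U)\<close> the Weyl-Ricci tensor is 0 while the right side is
        \<open>k * exp (- f q)\<close>.\<close>
      have "k = 0"
        using ric[of "C.U (cmap d p)" "C.U (cmap d p)"]
        by (simp add: C.ricci_weyl_U[OF x] C.g_U[OF x] C.\<theta>_U[OF x])
      then show ?thesis
        using C.ricci_weyl[OF x, of v w] ric[of v w] assms(2) by (simp add: field_simps)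
    qed
    then show "quasi_einstein A g \<theta>"
      unfolding quasi_einstein_def
      by (intro exI[of _ "\<lambda>_. n / 2"] exI[of _ "\<lambda>_. - (n / 2)"]) (simp add: smooth_fun_const)
  next
    assume "quasi_einstein A g \<theta>"
    then obtain \<alpha> \<beta> where qe: "\<And>d p v w. d \<in> A \<Longrightarrow> p \<in> cdom d \<Longrightarrow> ricci (g d) (cmap d p) v w =
        \<alpha> p * g d (cmap d p) v w + \<beta> p * (\<theta> d (cmap d p) v * \<theta> d (cmap d p) w)"
      unfolding quasi_einstein_def by blast
    have flat: "ricci_of (lee_chart.weyl (g d) (\<theta> d)) (cmap d p) v w = 0"
      if d: "d \<in> A" and p: "p \<in> cdom d" for d p v w
    proof -
      interpret C: vaisman_chart "cimg d" "g d" "\<theta> d" "J d"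
        by (rule chart[OF d])
      have x: "cmap d p \<in> cimg d"
        using p by (rule M.cmap_in)
      \<comment> \<open>\<open>\<theta>(J U) = 0\<close> removes \<open>\<beta>\<close>, and
        \<open>J U\<close> has length one.\<close>
      have \<alpha>: "\<alpha> p = n / 2"
        using qe[OF d p, of "J d (cmap d p) (C.U (cmap d p))" "J d (cmap d p) (C.U (cmap d p))"] assms(2)
        by (simp add: C.ricci_JU[OF x] C.g_JU[OF x] C.\<theta>_JU[OF x])
      have \<beta>: "\<beta> p = - \<alpha> p"
        using qe[OF d p, of "C.U (cmap d p)" "C.U (cmap d p)"]
        by (simp add: C.ricci_U[OF x] C.g_U[OF x] C.\<theta>_U[OF x])
      then show ?thesis
        using assms(2) by (simp add: C.ricci_weyl[OF x] qe[OF d p] \<alpha> \<beta> field_simps)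
    qed
    \<comment> \<open>The Einstein constant is 0: the Ricci tensor of the cover metric is the lift
      of the vanishing \<open>Ric\<^sup>D\<close>.\<close>
    have "ricci (kaehler_cover_metric A \<pi> f g c) x v w = 0 * kaehler_cover_metric A \<pi> f g c x v w"
      if c: "c \<in> B" and x: "x \<in> cimg c" for c x v w
    proof -
      have q: "cinv c x \<in> cdom c" "cmap c (cinv c x) = x"
        using N.cinv_in[OF c x] N.cmap_cinv[OF x] by auto
      then obtain d where d: "d \<in> A" "\<pi> (cinv c x) \<in> cdom d"
        using surj M.covering N.covering c by blast
      show ?thesis
        using cover[OF c d(1) q(1) d(2)] flat[OF d] q(2) by (metis mult_zero_left)
    qed
    then show "einstein_weyl B A \<pi> f g"
      unfolding einstein_weyl_def einstein_metric_def by blast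
  qed
qed

end
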